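(* Let $\alpha>1$ and $f_a(x)=-|x|^{\alpha}+a$. Let $\bar a_1$ be the value such that the set of parameters $\bar a$ for which the kneading sequence of $f_a$ is $RLRL\ldots$ (i.e. $(2k+1)_a>0$ and $(2k+2)_a<0$ for all $k\ge0$) is the half-line $(-\infty,\bar a_1)$. For $\bar a\in(-\infty,\bar a_1)$ and all non-negative integers $n$, the ratio functions $$r^n_e=\frac{|(2n+4)_a-(2n+2)_a|}{|(2n+2)_a-(2n)_a|}\quad\text{and}\quad r^n_o=\frac{|(2n+5)_a-(2n+3)_a|}{|(2n+3)_a-(2n+1)_a|}$$ are strictly increasing in $\bar a$. Moreover, when the parameter increases from $\bar a$ to $\bar a'$ within $(-\infty,\bar a_1)$, then for every $n\in\mathbb{Z}_+$ $$p_{(n+2)_{a'},n_{a'}}\big((n+4)_{a'}\big)-p_{(n+2)_a,n_a}\big((n+4)_a\big)>p_{1,-1}(2_{a'})-p_{1,-1}(2_a).$$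
   Context: Poincaré coordinates: for real $p\neq q$ and $x$ strictly between $p$ and $q$ (the oriented open interval $(p,q)$, where $p>q$ is allowed), $p_{p,q}(x)=\ln\frac{x-p}{q-x}$. Rescaled orbit: for $a>1$ and $n\ge0$, $n_a=f_a^n(0)/f_a(0)$ (so $0_a=0$, $1_a=1$), i.e. the $n$-th iterate of $0$ under $x\mapsto1-a^{\alpha-1}|x|^\alpha$; when $2_a\in(-1,0)$ the parameter is $\bar a=p_{0,1}(|2_a|)=\ln\frac{|2_a|}{1-|2_a|}$, which increases with $a$. The kneading symbol of $n_a$ is $R$ if $n_a>0$, $L$ if $n_a<0$. *)

theory Defs
  imports "HOL-Analysis.Analysis"
begin

text \<open>Rescaled orbit: n-th iterate of 0 under x \<mapsto> 1 - a^(alpha-1) |x|^alpha.\<close>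
definition orb :: "real \<Rightarrow> real \<Rightarrow> nat \<Rightarrow> real" where
  "orb alpha a n = ((\<lambda>x. 1 - a powr (alpha - 1) * \<bar>x\<bar> powr alpha) ^^ n) 0"

definition pc :: "real \<Rightarrow> real \<Rightarrow> real \<Rightarrow> real" where
  "pc p q x = ln ((x - p) / (q - x))"

definition abar :: "real \<Rightarrow> real \<Rightarrow> real" where
  "abar alpha a = pc 0 1 \<bar>orb alpha a 2\<bar>"

definition kneadRL :: "real \<Rightarrow> real \<Rightarrow> bool" where
  "kneadRL alpha a \<longleftrightarrow> (\<forall>k. orb alpha a (2*k+1) > 0 \<and> orb alpha a (2*k+2) < 0)"

definition r_e :: "real \<Rightarrow> real \<Rightarrow> nat \<Rightarrow> real" where
  "r_e alpha a n = \<bar>orb alpha a (2*n+4) - orb alpha a (2*n+2)\<bar> /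
                   \<bar>orb alpha a (2*n+2) - orb alpha a (2*n)\<bar>"

definition r_o :: "real \<Rightarrow> real \<Rightarrow> nat \<Rightarrow> real" where
  "r_o alpha a n = \<bar>orb alpha a (2*n+5) - orb alpha a (2*n+3)\<bar> /
                   \<bar>orb alpha a (2*n+3) - orb alpha a (2*n+1)\<bar>"

end

theory Submission
  imports Defs
begin

text \<open>
  Put $t = |2_a|$ and $E_n = |n_a|$. The rescaled orbit depends on $a$ only through $t$, and $t$ increases with
  $\bar a$; the claim is that $\frac{d}{dt} p_{(n+2),n}(n+4)$ exceeds
  $\frac{d}{dt} \ln\frac{1+t}{1-t} = \frac{2}{1-t^2}$ for every $n$.

  In logarithmic coordinates one step of the map multiplies the gaps between $E_n$, $E_{n+2}$, $E_{n+4}$ by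
  $\alpha$. It raises the derivative of the Poincare coordinate when $E_n < E_{n+2}$, that is for
  $n \equiv 0, 3 \pmod 4$, and may lower it otherwise. The loss at step $n+2$ is paid by the gain at step $n$,
  because the gap involved at $n+2$ is part of the gap at $n$. What is not paid that way is controlled by the
  growth rate of the outer gap, and for odd indices by the bound $\alpha s \le \ln 2$ on the total logarithmic
  gap. This gives an invariant that is carried along in blocks of four steps, so everything reduces to an
  explicit estimate at the points $0, 1, 2, 3, 4$.
\<close>

text \<open>In logarithms only velocities of gaps matter: the velocity of the middle point occurs in
  both difference quotients, as does the term 1/(1+t) from the explicit parameter, and both cancel.
  The obstacle is that a single gap velocity may be negative: the gap next to the smallest point can
  shrink as t grows, and then the weight R works against the coordinate. The invariant therefore
  bounds the coordinate velocity and the rates of the outer gaps, and the shrinking is charged to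
  the surplus of the coordinate velocity over the bound. A second obstacle is the start: the loss at
  index 1 has no earlier gain, as there is no index -1. It is charged to index 0, so the explicit
  estimate must beat 2/(1-t^2) by \<alpha>-1 times a gap velocity. This holds only thanks to an
  inequality between \<alpha> and t that the sign of 4_a forces. Finally, integrating the derivative
  bound needs every intermediate parameter to be admissible, so the admissible parameters are shown
  to be closed downwards.\<close>

subsection \<open>Distortion of logarithmic gaps under a power map\<close>

text \<open>
  If the two gaps of a triple of logarithms have lengths $x$, $\sigma$ and velocities $\dot x$, $\dot\sigma$,
  then multiplying all gaps by $\alpha$ changes the velocity of the Poincare coordinate of the middle point by
  $\pm(P(\sigma)\dot\sigma + R(x)\dot x)$, with the two weights below.
\<close>

definition fR :: "real \<Rightarrow> real \<Rightarrow> real" where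
  "fR \<alpha> d = 1 / (exp d - 1) - \<alpha> / (exp (\<alpha> * d) - 1)"

definition fP :: "real \<Rightarrow> real \<Rightarrow> real" where
  "fP \<alpha> d = \<alpha> / (1 - exp (- (\<alpha> * d))) - 1 / (1 - exp (- d))"

section \<open>Bounds and monotonicity of the two weights\<close>

lemma inv_one_minus_exp:
  fixes d :: real assumes "d \<noteq> 0"
  shows "1 / (1 - exp (- d)) = 1 + 1 / (exp d - 1)"
proof -
  have "exp d \<noteq> 1" using assms by simp
  then have "exp d - 1 \<noteq> 0" by simp
  then show ?thesis by (simp add: exp_minus field_simps)
qed

lemma fP_plus_fR:
  assumes "\<alpha> > 1" "d > 0"
  shows "fP \<alpha> d + fR \<alpha> d = \<alpha> - 1"
proof -
  have "\<alpha> / (1 - exp (- (\<alpha> * d))) = \<alpha> * (1 / (1 - exp (- (\<alpha> * d))))" by simp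
  also have "\<dots> = \<alpha> * (1 + 1 / (exp (\<alpha> * d) - 1))"
    using inv_one_minus_exp[of "\<alpha> * d"] assms by auto
  finally show ?thesis
    unfolding fP_def fR_def using inv_one_minus_exp[of d] assms by (simp add: algebra_simps)
qed

lemma exp_Bernoulli:
  fixes \<alpha> d :: real assumes "\<alpha> \<ge> 1" "d \<ge> 0"
  shows "\<alpha> * (exp d - 1) \<le> exp (\<alpha> * d) - 1"
proof -
  have "(\<lambda>d. exp (\<alpha> * d) - 1 - \<alpha> * (exp d - 1)) 0 \<le> (\<lambda>d. exp (\<alpha> * d) - 1 - \<alpha> * (exp d - 1)) d"
  proof (rule DERIV_nonneg_imp_nondecreasing[OF assms(2)])
    fix x :: real assume "0 \<le> x" "x \<le> d"
    then have "x \<le> \<alpha> * x" using assms by (simp add: mult_le_cancel_right1)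
    then have "0 \<le> \<alpha> * (exp (\<alpha> * x) - exp x)" using assms by simp
    moreover have "DERIV (\<lambda>d. exp (\<alpha> * d) - 1 - \<alpha> * (exp d - 1)) x :> \<alpha> * (exp (\<alpha> * x) - exp x)"
      by (auto intro!: derivative_eq_intros simp: algebra_simps)
    ultimately show "\<exists>y. DERIV (\<lambda>d. exp (\<alpha> * d) - 1 - \<alpha> * (exp d - 1)) x :> y \<and> 0 \<le> y" by blast
  qed
  then show ?thesis by simp
qed

lemma exp_Bernoulli_neg:
  fixes \<alpha> d :: real assumes "\<alpha> \<ge> 1" "d \<ge> 0"
  shows "1 - exp (- (\<alpha> * d)) \<le> \<alpha> * (1 - exp (- d))"
proof -
  have "(\<lambda>d. \<alpha> * (1 - exp (- d)) - (1 - exp (- (\<alpha> * d)))) 0 \<le> (\<lambda>d. \<alpha> * (1 - exp (- d)) - (1 - exp (- (\<alpha> * d)))) d"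
  proof (rule DERIV_nonneg_imp_nondecreasing[OF assms(2)])
    fix x :: real assume "0 \<le> x" "x \<le> d"
    then have "x \<le> \<alpha> * x" using assms by (simp add: mult_le_cancel_right1)
    then have "0 \<le> \<alpha> * (exp (-x) - exp (- (\<alpha> * x)))" using assms by simp
    moreover have "DERIV (\<lambda>d. \<alpha> * (1 - exp (- d)) - (1 - exp (- (\<alpha> * d)))) x :> \<alpha> * (exp (-x) - exp (- (\<alpha> * x)))"
      by (auto intro!: derivative_eq_intros simp: algebra_simps)
    ultimately show "\<exists>y. DERIV (\<lambda>d. \<alpha> * (1 - exp (- d)) - (1 - exp (- (\<alpha> * d)))) x :> y \<and> 0 \<le> y" by blast
  qed
  then show ?thesis by simp
qed

lemma fR_nonneg:
  assumes "\<alpha> > 1" "d > 0"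
  shows "0 \<le> fR \<alpha> d"
proof -
  have e: "exp d - 1 > 0" "exp (\<alpha> * d) - 1 > 0" using assms by auto
  have "\<alpha> / (exp (\<alpha> * d) - 1) \<le> \<alpha> / (\<alpha> * (exp d - 1))"
    using e assms exp_Bernoulli[of \<alpha> d] by (intro divide_left_mono) auto
  also have "\<dots> = 1 / (exp d - 1)" using assms by simp
  finally show ?thesis unfolding fR_def by simp
qed

text \<open>Caps the effect of a shrinking inner gap: by \<open>gap_increase\<close> its velocity
  carries the factor 1 - exp(-x), so R times this velocity is at most |S - r \<pi>| in size.\<close>

lemma fR_bound:
  assumes "\<alpha> > 1" "d > 0"
  shows "fR \<alpha> d * (1 - exp (- d)) \<le> 1"
proof -
  have e: "exp d - 1 > 0" "exp (\<alpha> * d) - 1 > 0" "exp (-d) < 1" using assms by auto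
  have "fR \<alpha> d \<le> 1 / (exp d - 1)" unfolding fR_def using e assms by simp
  then have "fR \<alpha> d * (1 - exp (- d)) \<le> 1 / (exp d - 1) * (1 - exp (- d))"
    using e by (intro mult_right_mono) auto
  also have "\<dots> = exp (-d)" using e by (simp add: exp_minus field_simps)
  finally show ?thesis using e by linarith
qed

lemma sinh_scale:
  fixes \<alpha> h :: real assumes "\<alpha> \<ge> 1" "h \<ge> 0"
  shows "\<alpha> * sinh h \<le> sinh (\<alpha> * h)"
proof -
  have "(\<lambda>d. sinh (\<alpha> * d) - \<alpha> * sinh d) 0 \<le> (\<lambda>d. sinh (\<alpha> * d) - \<alpha> * sinh d) h"
  proof (rule DERIV_nonneg_imp_nondecreasing[OF assms(2)])
    fix x :: real assume "0 \<le> x" "x \<le> h"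
    then have "x \<le> \<alpha> * x" using assms by (simp add: mult_le_cancel_right1)
    then have "cosh x \<le> cosh (\<alpha> * x)" using \<open>0 \<le> x\<close> assms
      by (subst cosh_real_nonneg_le_iff) auto
    then have "0 \<le> \<alpha> * (cosh (\<alpha> * x) - cosh x)" using assms by simp
    moreover have "DERIV (\<lambda>d. sinh (\<alpha> * d) - \<alpha> * sinh d) x :> \<alpha> * (cosh (\<alpha> * x) - cosh x)"
      by (auto intro!: derivative_eq_intros simp: algebra_simps)
    ultimately show "\<exists>y. DERIV (\<lambda>d. sinh (\<alpha> * d) - \<alpha> * sinh d) x :> y \<and> 0 \<le> y" by blast
  qed
  then show ?thesis by simp
qed

lemma exp_sinh_sq:
  fixes d :: real assumes "d > 0"
  shows "exp (- d) / (1 - exp (- d))\<^sup>2 = 1 / (2 * sinh (d / 2))\<^sup>2"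
proof -
  define q where "q = exp (d / 2)"
  have q: "q > 1" "exp (-d) = 1 / q\<^sup>2" "2 * sinh (d/2) = q - 1/q"
    using assms by (auto simp: q_def power2_eq_square exp_minus sinh_field_def inverse_eq_divide simp flip: exp_add)
  have "q\<^sup>2 - 1 \<noteq> 0" using q(1) by (simp add: power2_eq_1_iff)
  moreover have "1 - 1 / q\<^sup>2 = (q\<^sup>2 - 1) / q\<^sup>2" "q - 1/q = (q\<^sup>2 - 1) / q"
    using q(1) by (auto simp: field_simps power2_eq_square)
  ultimately show ?thesis unfolding q(2,3) using q(1)
    by (simp add: field_simps power2_eq_square)
qed

text \<open>The derivative is 1/(2 sinh(x/2))^2 - \<alpha>^2/(2 sinh(\<alpha>x/2))^2, so
  \<open>sinh_scale\<close> decides its sign.\<close>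

lemma fP_mono:
  assumes "\<alpha> > 1" "0 < c" "c \<le> d"
  shows "fP \<alpha> c \<le> fP \<alpha> d"
proof (rule DERIV_nonneg_imp_nondecreasing[OF assms(3)])
  fix x assume "c \<le> x" "x \<le> d"
  then have x: "x > 0" using assms by simp
  have e: "1 - exp (- x) > 0" "1 - exp (- (\<alpha> * x)) > 0" using x assms by auto
  define D where "D = exp (- x) / (1 - exp (- x))\<^sup>2 - \<alpha>\<^sup>2 * (exp (- (\<alpha> * x)) / (1 - exp (- (\<alpha> * x)))\<^sup>2)"
  have "DERIV (fP \<alpha>) x :> D"
    unfolding fP_def [abs_def] D_def using e
    by (auto intro!: derivative_eq_intros simp: power2_eq_square)
  moreover have "D \<ge> 0"
  proof -
    have s: "0 < sinh (x/2)" using x by simp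
    have "\<alpha> * sinh (x/2) \<le> sinh (\<alpha> * x / 2)" using sinh_scale[of \<alpha> "x/2"] x assms by simp
    then have le: "(\<alpha> * (2 * sinh (x/2)))\<^sup>2 \<le> (2 * sinh (\<alpha> * x / 2))\<^sup>2"
      using s assms by (intro power_mono) auto
    have pos: "0 < (\<alpha> * (2 * sinh (x/2)))\<^sup>2" using s assms by simp
    have "\<alpha>\<^sup>2 * (1 / (2 * sinh (\<alpha> * x / 2))\<^sup>2) \<le> \<alpha>\<^sup>2 * (1 / (\<alpha> * (2 * sinh (x/2)))\<^sup>2)"
      using le pos assms by (intro mult_left_mono divide_left_mono mult_pos_pos) (auto intro: less_le_trans)
    also have "\<dots> = 1 / (2 * sinh (x/2))\<^sup>2" using assms s by (simp add: field_simps)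
    finally show ?thesis unfolding D_def using exp_sinh_sq[of x] exp_sinh_sq[of "\<alpha> * x"] x assms by simp
  qed
  ultimately show "\<exists>y. DERIV (fP \<alpha>) x :> y \<and> 0 \<le> y" by blast
qed

lemma tanh_scale:
  fixes \<alpha> h :: real assumes "\<alpha> \<ge> 1" "h \<ge> 0"
  shows "tanh (\<alpha> * h) \<le> \<alpha> * tanh h"
proof -
  have "(\<lambda>d. \<alpha> * tanh d - tanh (\<alpha> * d)) 0 \<le> (\<lambda>d. \<alpha> * tanh d - tanh (\<alpha> * d)) h"
  proof (rule DERIV_nonneg_imp_nondecreasing[OF assms(2)])
    fix x :: real assume "0 \<le> x" "x \<le> h"
    then have "x \<le> \<alpha> * x" using assms by (simp add: mult_le_cancel_right1)
    then have "tanh x \<le> tanh (\<alpha> * x)" by simp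
    moreover have "0 \<le> tanh x" using \<open>0 \<le> x\<close> by simp
    ultimately have "(tanh x)\<^sup>2 \<le> (tanh (\<alpha> * x))\<^sup>2" by (intro power_mono) auto
    then have "0 \<le> \<alpha> * ((tanh (\<alpha> * x))\<^sup>2 - (tanh x)\<^sup>2)" using assms by simp
    moreover have "DERIV (\<lambda>d. \<alpha> * tanh d - tanh (\<alpha> * d)) x :> \<alpha> * ((tanh (\<alpha> * x))\<^sup>2 - (tanh x)\<^sup>2)"
      by (auto intro!: derivative_eq_intros simp: algebra_simps)
    ultimately show "\<exists>y. DERIV (\<lambda>d. \<alpha> * tanh d - tanh (\<alpha> * d)) x :> y \<and> 0 \<le> y" by blast
  qed
  then show ?thesis by simp
qed

lemma inv_one_minus_exp_tanh:
  fixes d :: real assumes "d > 0"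
  shows "1 / (1 - exp (- d)) = (1 + 1 / tanh (d / 2)) / 2"
proof -
  have "tanh (d/2) = (1 - exp (-d)) / (1 + exp (-d))"
    using tanh_real_altdef[of "d/2"] by simp
  moreover have "1 - exp (-d) > 0" "1 + exp (-d) > 0" using assms by (auto intro: add_pos_pos)
  ultimately show ?thesis by (simp add: field_simps)
qed

text \<open>With h = d/2 this is \<alpha> coth(\<alpha>h) >= coth h. The constant (\<alpha>-1)/2 is
  the common limit of both weights as the gap tends to 0, and it separates them: no value of
  \<open>fR\<close> exceeds a value of \<open>fP\<close>, even at different gaps.\<close>

lemma fP_ge:
  assumes "\<alpha> > 1" "d > 0"
  shows "(\<alpha> - 1) / 2 \<le> fP \<alpha> d"
proof -
  have t: "0 < tanh (d/2)" "0 < tanh (\<alpha> * d/2)" using assms by auto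
  have "tanh (\<alpha> * d / 2) \<le> \<alpha> * tanh (d / 2)" using tanh_scale[of \<alpha> "d/2"] assms by simp
  then have "1 / tanh (d/2) \<le> \<alpha> / tanh (\<alpha> * d / 2)" using t by (simp add: field_simps)
  moreover have "fP \<alpha> d = \<alpha> * ((1 + 1 / tanh (\<alpha> * d / 2)) / 2) - (1 + 1 / tanh (d / 2)) / 2"
    unfolding fP_def using inv_one_minus_exp_tanh[of d] inv_one_minus_exp_tanh[of "\<alpha> * d"] assms
    by (metis (no_types, lifting) mult_pos_pos divide_inverse mult_1 less_trans zero_less_one)
  moreover have "\<alpha> / tanh (\<alpha> * d / 2) = \<alpha> * (1 / tanh (\<alpha> * d / 2))" by simp
  ultimately show ?thesis by argo
qed

lemma fR_le:
  assumes "\<alpha> > 1" "d > 0"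
  shows "fR \<alpha> d \<le> (\<alpha> - 1) / 2"
  using fP_plus_fR[OF assms] fP_ge[OF assms] by simp

lemma fP_le:
  assumes "\<alpha> > 1" "d > 0"
  shows "fP \<alpha> d \<le> \<alpha> - 1"
  using fP_plus_fR[OF assms] fR_nonneg[OF assms] by simp

text \<open>By convexity of exp the right-hand side lies above its chord over [0, ln 2], which ends
  at height 3/4; what remains is ln 2 <= 3/4.\<close>

lemma le_one_minus_exp:
  fixes L :: real assumes "0 \<le> L" "L \<le> ln 2"
  shows "L \<le> 1 - exp (- (2 * L))"
proof -
  have cv: "convex_on UNIV (exp :: real \<Rightarrow> real)" by (rule exp_convex)
  define l :: real where "l = ln 2"
  have l: "l > 0" "l \<le> 3/4" unfolding l_def using ln2_le_25_over_36 by auto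
  define u where "u = L / l"
  have u: "0 \<le> u" "u \<le> 1" "L = u * l" using assms l unfolding u_def l_def by auto
  have "exp ((1 - u) *\<^sub>R 0 + u *\<^sub>R (- (2 * l))) \<le> (1 - u) * exp 0 + u * exp (- (2 * l))"
    using u by (intro convex_onD[OF cv]) auto
  moreover have "(1 - u) *\<^sub>R 0 + u *\<^sub>R (- (2 * l)) = - (2 * L)" using u(3) by simp
  ultimately have "exp (- (2 * L)) \<le> (1 - u) * exp 0 + u * exp (- (2 * l))" by (simp only:)
  moreover have "exp (- (2 * l)) = 1 / 4"
  proof -
    have "exp (2 * l) = exp l * exp l" by (simp flip: exp_add)
    then show ?thesis by (simp add: l_def exp_minus)
  qed
  ultimately have "exp (- (2 * L)) \<le> (1 - u) + u * (1 / 4)" by simp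
  moreover have "L \<le> u * (3/4)" using mult_left_mono[of l "3/4" u] u l by simp
  ultimately show ?thesis by linarith
qed

text \<open>Multiplied out, the claim is \<alpha>(1 - exp(-s)) <= 1 - exp(-2\<alpha>s). The left
  side is at most \<alpha>s, and then \<open>le_one_minus_exp\<close> applies; here the bound ln 2
  on the logarithmic gap does its work.\<close>

lemma fP_small_gap:
  assumes "\<alpha> > 1" "0 < s" "\<alpha> * s \<le> ln 2"
  shows "fP \<alpha> s * (exp s - 1) * exp ((\<alpha> - 1) * s) \<le> 1"
proof -
  define E where "E = exp (\<alpha> * s)"
  define g where "g = exp s"
  have E: "E > 1" "g > 1" using assms by (auto simp: E_def g_def)
  have x: "exp (- s) = 1 / g" "exp (- (\<alpha> * s)) = 1 / E" "exp ((\<alpha> - 1) * s) = E / g"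
    "exp (- (2 * (\<alpha> * s))) = 1 / E\<^sup>2"
    by (auto simp: E_def g_def exp_minus field_simps power2_eq_square exp_diff simp flip: exp_add)
  have "1 - exp (- s) \<le> s" using exp_ge_add_one_self[of "-s"] by linarith
  then have "\<alpha> * (1 - 1 / g) \<le> \<alpha> * s" using assms x by simp
  also have "\<dots> \<le> 1 - exp (- (2 * (\<alpha> * s)))"
    using assms by (intro le_one_minus_exp) auto
  finally have "\<alpha> * (1 - 1 / g) \<le> 1 - 1 / E\<^sup>2" using x by simp
  then have "\<alpha> * (1 - 1 / g) * (E\<^sup>2 / (E - 1)) \<le> (1 - 1 / E\<^sup>2) * (E\<^sup>2 / (E - 1))"
    using E by (intro mult_right_mono) auto
  also have "\<dots> = E + 1" using E by (simp add: field_simps power2_eq_square)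
  finally have *: "\<alpha> * (1 - 1 / g) * (E\<^sup>2 / (E - 1)) - E \<le> 1" by linarith
  have "fP \<alpha> s * (exp s - 1) * exp ((\<alpha> - 1) * s) = (\<alpha> / (1 - 1 / E) - 1 / (1 - 1 / g)) * (g - 1) * (E / g)"
    unfolding fP_def x by (simp add: g_def)
  also have "\<dots> = \<alpha> * (1 - 1 / g) * (E\<^sup>2 / (E - 1)) - E"
  proof -
    have "\<alpha> / (1 - 1 / E) = \<alpha> * E / (E - 1)" "1 / (1 - 1 / g) = g / (g - 1)"
      using E by (auto simp: field_simps)
    moreover have "\<alpha> * E / (E - 1) * (g - 1) * (E / g) = \<alpha> * (1 - 1 / g) * (E\<^sup>2 / (E - 1))"
    proof -
      have "\<alpha> * E / (E - 1) * (g - 1) * (E / g) = \<alpha> * ((g - 1) / g) * (E\<^sup>2 / (E - 1))"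
        by (simp add: power2_eq_square mult_ac)
      moreover have "(g - 1) / g = 1 - 1 / g" using E by (simp add: diff_divide_distrib)
      ultimately show ?thesis by simp
    qed
    moreover have "g / (g - 1) * (g - 1) * (E / g) = E" using E by simp
    ultimately show ?thesis by (simp only: left_diff_distrib)
  qed
  finally show ?thesis using * by simp
qed

subsection \<open>Gap velocities along blocks of four steps\<close>

text \<open>
  In the next two lemmas $\pi$ is the velocity of the Poincare coordinate of the middle point, $S$ and $z$ are the
  growth rates of \<open>exp gap - 1\<close> for the outer and the inner gap, and $r$ is the ratio of the interval lengths.
\<close>

lemma gap_increase:
  fixes x \<sigma> dx d\<sigma> \<pi> :: real
  assumes "x > 0" "\<sigma> > 0"
    and \<pi>: "\<pi> = d\<sigma> / (1 - exp (- \<sigma>)) - dx / (exp x - 1)"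
  defines "S \<equiv> (dx + d\<sigma>) / (1 - exp (- (x + \<sigma>)))"
    and "r \<equiv> (1 - exp (- \<sigma>)) / (1 - exp (- (x + \<sigma>)))"
    and "z \<equiv> d\<sigma> / (1 - exp (- \<sigma>))"
  shows "0 < r" "r < 1" "z = exp (- x) * S + (1 - exp (- x) * r) * \<pi>"
    "dx = (1 - exp (- x)) * (S - r * \<pi>)"
proof -
  define a where "a = exp (- x)"
  define g where "g = exp (- \<sigma>)"
  have ag: "0 < a" "a < 1" "0 < g" "g < 1" using assms by (auto simp: a_def g_def)
  have agg: "a * g < g" using ag by simp
  then have ag1: "1 - a * g > 0" using ag by linarith
  have "exp (- (x + \<sigma>)) = a * g" by (simp add: a_def g_def flip: exp_add)
  moreover have "exp x - 1 = (1 - a) / a" by (simp add: a_def exp_minus field_simps)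
  ultimately have e: "exp (- (x + \<sigma>)) = a * g" "exp x - 1 = (1 - a) / a" "exp (- x) = a" "exp (- \<sigma>) = g"
    by (auto simp: a_def g_def)
  have r: "r = (1 - g) / (1 - a * g)" unfolding r_def e ..
  show "0 < r" unfolding r using ag ag1 by simp
  show "r < 1" unfolding r using ag1 agg by (simp add: divide_less_eq)
  have d\<sigma>: "d\<sigma> = (1 - g) * z" using ag by (simp add: z_def e)
  have "\<pi> = z - dx * a / (1 - a)" using \<pi> by (simp add: z_def e)
  then have dx: "dx = (z - \<pi>) * (1 - a) / a" using ag by (simp add: field_simps)
  have S: "S * (1 - a * g) = dx + d\<sigma>" unfolding S_def e using ag1 by simp
  have rr: "r * (1 - a * g) = 1 - g" using ag1 by (simp add: r)
  have "(exp (- x) * S + (1 - exp (- x) * r) * \<pi>) * (1 - a * g)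
      = a * (S * (1 - a * g)) + ((1 - a * g) - a * (r * (1 - a * g))) * \<pi>"
    by (simp add: e algebra_simps)
  also have "\<dots> = z * (1 - a * g)" unfolding S rr unfolding dx d\<sigma> using ag by (simp add: field_simps)
  finally show "z = exp (- x) * S + (1 - exp (- x) * r) * \<pi>" using ag1 by simp
  have "(1 - exp (- x)) * (S - r * \<pi>) * (1 - a * g) = (1 - a) * (S * (1 - a * g) - (r * (1 - a * g)) * \<pi>)"
    by (simp add: e algebra_simps)
  also have "\<dots> = dx * (1 - a * g)" unfolding S rr unfolding dx d\<sigma> using ag by (simp add: field_simps)
  finally show "dx = (1 - exp (- x)) * (S - r * \<pi>)" using ag1 by simp
qed

lemma gap_decrease:
  fixes m y dm dy \<pi> :: real
  assumes "m > 0" "y > 0"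
    and \<pi>: "\<pi> = dm / (exp m - 1) - dy / (1 - exp (- y))"
  defines "z \<equiv> (dm + dy) / (1 - exp (- (m + y)))"
    and "r \<equiv> (exp m - 1) / (exp (m + y) - 1)"
  shows "0 < r" "r < 1" "dm / (1 - exp (- m)) = z + (1 - r) * \<pi>"
    "(1 - r) * (1 - exp (- (m + y))) * exp (- m) = exp (- m) - exp (- (m + y))"
proof -
  define p where "p = exp m"
  define q where "q = exp y"
  have pq: "p > 1" "q > 1" using assms by (auto simp: p_def q_def)
  have pq2: "p * q > p" using pq by simp
  then have pq1: "p * q - 1 > 0" using pq by linarith
  have e: "exp (m + y) = p * q" "exp (- (m + y)) = 1 / (p * q)" "exp (- m) = 1 / p" "exp (- y) = 1 / q" "exp m = p"
    by (auto simp: p_def q_def exp_minus exp_add exp_diff field_simps)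
  have r: "r = (p - 1) / (p * q - 1)" unfolding r_def e ..
  show "0 < r" "r < 1" unfolding r using pq pq2 pq1 by (auto simp: divide_simps)
  have r1: "(1 - r) * (p * q - 1) = p * (q - 1)" using pq1 by (simp add: r field_simps)
  have dy1: "dy / (1 - 1 / q) = dy * q / (q - 1)" using pq by (simp add: field_simps)
  have "1 - 1 / (p * q) = (p * q - 1) / (p * q)" using pq by (simp add: field_simps)
  then have z1: "z * (p * q - 1) = (dm + dy) * (p * q)" unfolding z_def e using pq1 by simp
  have m1: "dm / (1 - 1 / p) = dm * p / (p - 1)" using pq by (simp add: field_simps)
  have "(z + (1 - r) * \<pi>) * (p * q - 1) = z * (p * q - 1) + ((1 - r) * (p * q - 1)) * \<pi>"
    by (simp add: algebra_simps)
  also have "\<dots> = (dm + dy) * (p * q) + p * (q - 1) * (dm / (p - 1) - dy * q / (q - 1))"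
    unfolding z1 r1 \<pi> e dy1 ..
  also have "\<dots> = dm * (p * q + p * (q - 1) / (p - 1))"
  proof -
    have c: "p * (q - 1) * (dy * q / (q - 1)) = dy * (p * q)"
      "p * (q - 1) * (dm / (p - 1)) = dm * (p * (q - 1) / (p - 1))" using pq by simp_all
    show ?thesis unfolding right_diff_distrib[of "p * (q - 1)"] c by (simp add: distrib_left distrib_right)
  qed
  also have "p * q + p * (q - 1) / (p - 1) = p * (p * q - 1) / (p - 1)"
    using pq by (simp add: field_simps)
  finally have "(z + (1 - r) * \<pi>) * (p * q - 1) = dm * p / (p - 1) * (p * q - 1)" by simp
  moreover have "p * q - 1 \<noteq> 0" using pq1 by simp
  ultimately have "z + (1 - r) * \<pi> = dm * p / (p - 1)" using mult_right_cancel by blast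
  then show "dm / (1 - exp (- m)) = z + (1 - r) * \<pi>" by (simp add: e m1)
  have "(1 - r) * (1 - 1 / (p * q)) * (1 / p) = (1 - r) * (p * q - 1) / (p * q * p)"
    using pq by (simp add: field_simps)
  also have "\<dots> = 1 / p - 1 / (p * q)" unfolding r1 using pq by (simp add: field_simps)
  finally show "(1 - r) * (1 - exp (- (m + y))) * exp (- m) = exp (- m) - exp (- (m + y))"
    unfolding e .
qed

text \<open>A nonnegative coordinate velocity forces dm >= 0, and R(m) <= P(y) <= P(m+y). For dy >=
  0 both weights may be raised to P(m+y). For dy < 0 the error made on dy is absorbed by that on dm,
  because -dy <= dm. The right-hand side is part of the gain two indices earlier, where m+y was a
  single gap.\<close>

lemma gap_loss:
  fixes m y dm dy \<pi> :: real
  assumes "\<alpha> > 1" "m > 0" "y > 0"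
    and "dm / (exp m - 1) - dy / (1 - exp (- y)) \<ge> 0" "dm + dy \<ge> 0"
  shows "fR \<alpha> m * dm + fP \<alpha> y * dy \<le> fP \<alpha> (m + y) * (dm + dy)"
proof -
  have e: "exp m - 1 > 0" "1 - exp (- y) > 0" using assms by auto
  have dm: "dm \<ge> 0"
  proof (rule ccontr)
    assume "\<not> dm \<ge> 0"
    then have "dm / (exp m - 1) < 0" "dy \<ge> 0" using e assms by (auto simp: divide_neg_pos)
    moreover have "dy / (1 - exp (- y)) \<ge> 0" using e \<open>dy \<ge> 0\<close> by simp
    ultimately show False using assms(4) by linarith
  qed
  have f: "fR \<alpha> m \<le> fP \<alpha> y" "fP \<alpha> y \<le> fP \<alpha> (m + y)"
    using fR_le[of \<alpha> m] fP_ge[of \<alpha> y] fP_mono[of \<alpha> y "m + y"] assms by auto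
  show ?thesis
  proof (cases "dy \<ge> 0")
    case True
    have "fR \<alpha> m * dm \<le> fP \<alpha> (m + y) * dm" "fP \<alpha> y * dy \<le> fP \<alpha> (m + y) * dy"
      using f dm True by (auto intro!: mult_right_mono)
    then show ?thesis by (simp add: distrib_left)
  next
    case False
    have "(fP \<alpha> (m + y) - fP \<alpha> y) * (- dy) \<le> (fP \<alpha> (m + y) - fP \<alpha> y) * dm"
      using f assms(5) by (intro mult_left_mono) auto
    also have "\<dots> \<le> (fP \<alpha> (m + y) - fR \<alpha> m) * dm" using f dm by (intro mult_right_mono) auto
    finally show ?thesis by (simp add: algebra_simps)
  qed
qed

lemma fP_exp_le_one:
  assumes "\<alpha> > 1" "0 < s" "\<alpha> * s \<le> ln 2"
  shows "fP \<alpha> s * (exp s - 1) \<le> 1"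
proof -
  have p: "fP \<alpha> s \<ge> 0" using fP_ge[of \<alpha> s] assms by simp
  have "fP \<alpha> s * (exp s - 1) * 1 \<le> fP \<alpha> s * (exp s - 1) * exp ((\<alpha> - 1) * s)"
    using p assms by (intro mult_left_mono) auto
  then show ?thesis using fP_small_gap[OF assms] by linarith
qed

text \<open>Passage from the gap m+y to its lower part m, at an odd index and at the even one after
  it. The rate of m exceeds that of m+y by 1-r times the coordinate velocity. For the second bound,
  P(m) dm has to be covered by P(m+y)(dm+dy) and a share of \<pi>2, after \<open>gap_loss\<close>
  has replaced \<pi>1 by \<pi>2.\<close>

lemma contracting_pair:
  fixes z z' :: real
  assumes "\<alpha> > 1" "m > 0" "y > 0" "\<alpha> * (m + y) \<le> ln 2" "\<mu> > 0"
    and z: "z = (dm + dy) / (1 - exp (- (m + y)))" "z \<ge> \<mu>"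
    and z': "z' = (dm' + dy') / (1 - exp (- (m' + y')))" "z' \<ge> \<mu> + fP \<alpha> (m + y) * (dm + dy)"
    and pos': "m' > 0" "y' > 0"
    and \<pi>1: "\<pi>1 = dm / (exp m - 1) - dy / (1 - exp (- y))" "\<pi>1 \<ge> 0"
    and \<pi>2: "\<pi>2 = \<pi>1 - (fR \<alpha> m * dm + fP \<alpha> y * dy)"
      "\<pi>2 = dm' / (exp m' - 1) - dy' / (1 - exp (- y'))" "\<pi>2 \<ge> 0"
    and r: "(exp m' - 1) / (exp (m' + y') - 1) \<le> (exp m - 1) / (exp (m + y) - 1)"
  shows "dm / (1 - exp (- m)) \<ge> \<mu>"
    "dm' / (1 - exp (- m')) \<ge> \<mu> + fP \<alpha> m * dm"
proof -
  define r1 where "r1 = (exp m - 1) / (exp (m + y) - 1)"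
  define r2 where "r2 = (exp m' - 1) / (exp (m' + y') - 1)"
  define S where "S = dm / (1 - exp (- m))"
  note g1 = gap_decrease[OF assms(2,3) \<pi>1(1), folded r1_def z(1)]
  note g2 = gap_decrease[OF pos' \<pi>2(2), folded r2_def z'(1)]
  have em: "1 - exp (- m) > 0" "1 - exp (- (m + y)) > 0" using assms by auto
  have S: "S = z + (1 - r1) * \<pi>1" using g1(3) by (simp add: S_def)
  have "(1 - r1) * \<pi>1 \<ge> 0" using g1(2) \<pi>1(2) by simp
  then show "dm / (1 - exp (- m)) \<ge> \<mu>" using S z(2) unfolding S_def by linarith
  have d\<sigma>: "dm + dy = (1 - exp (- (m + y))) * z" using em by (simp add: z(1))
  then have d\<sigma>0: "dm + dy \<ge> 0" using em z(2) \<open>\<mu> > 0\<close> by simp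
  define W where "W = fP \<alpha> (m + y) * (1 - exp (- (m + y)))"
  define w where "w = fP \<alpha> m * (1 - exp (- m))"
  have loss: "\<pi>1 \<le> \<pi>2 + W * z"
    using gap_loss[of \<alpha> m y dm dy] \<pi>1 \<pi>2(1) assms(1-3) d\<sigma>0 d\<sigma> by (simp add: W_def)
  have "\<alpha> * m \<le> \<alpha> * (m + y)" using assms by simp
  then have am: "\<alpha> * m \<le> ln 2" using assms(4) by linarith
  have Pm: "fP \<alpha> m \<ge> 0" "fP \<alpha> m \<le> fP \<alpha> (m + y)"
    using fP_ge[of \<alpha> m] fP_mono[of \<alpha> m "m + y"] assms by auto
  have w: "0 \<le> w" using Pm em by (simp add: w_def)
  have "w = fP \<alpha> m * (exp m - 1) * exp (- m)" by (simp add: w_def exp_minus field_simps)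
  also have "\<dots> \<le> 1 * exp (- m)" using fP_exp_le_one[OF assms(1,2) am] by (intro mult_right_mono) auto
  finally have w': "w \<le> exp (- m)" by simp
  moreover have "exp (- m) \<le> 1" using assms by simp
  ultimately have w1: "w \<le> 1" by linarith
  have W0: "W \<ge> 0" using Pm em by (simp add: W_def)
  \<comment> \<open>By w <= exp(-m) and the last identity of \<open>gap_decrease\<close>, the second
    term is at most P(m+y)(exp(-m) - exp(-(m+y))). The first is at most P(m+y)(1 - exp(-m)), and the
    two bounds add up to W.\<close>
  have "w + w * (1 - r1) * W \<le> W"
  proof -
    have "w * ((1 - r1) * W) \<le> exp (- m) * ((1 - r1) * W)"
      using w' W0 g1(2) by (intro mult_right_mono mult_nonneg_nonneg) auto
    also have "\<dots> = fP \<alpha> (m + y) * (exp (- m) - exp (- (m + y)))"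
      unfolding W_def g1(4)[symmetric] by (simp add: algebra_simps)
    finally have "w * ((1 - r1) * W) \<le> fP \<alpha> (m + y) * (exp (- m) - exp (- (m + y)))" .
    moreover have "w \<le> fP \<alpha> (m + y) * (1 - exp (- m))"
      unfolding w_def using Pm em by (intro mult_right_mono) auto
    ultimately show ?thesis unfolding W_def by (simp add: algebra_simps)
  qed
  then have "(w + w * (1 - r1) * W) * z \<le> W * z" using z(2) assms(5) by (intro mult_right_mono) auto
  moreover have "w * (1 - r1) * \<pi>1 \<le> w * (1 - r1) * (\<pi>2 + W * z)"
    using loss w g1(2) by (intro mult_left_mono) auto
  moreover have "w * (1 - r1) * \<pi>2 \<le> (1 - r2) * \<pi>2"
  proof -
    have "w * (1 - r1) \<le> 1 * (1 - r1)" using w1 g1(2) by (intro mult_right_mono) auto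
    also have "\<dots> \<le> 1 - r2" using r by (simp add: r1_def r2_def)
    finally show ?thesis using \<pi>2(3) by (intro mult_right_mono) auto
  qed
  ultimately have "w * S \<le> W * z + (1 - r2) * \<pi>2" unfolding S by (simp add: algebra_simps)
  moreover have "w * S = fP \<alpha> m * dm" using em by (simp add: w_def S_def)
  moreover have "W * z = fP \<alpha> (m + y) * (dm + dy)" by (simp add: W_def d\<sigma>)
  ultimately show "dm' / (1 - exp (- m')) \<ge> \<mu> + fP \<alpha> m * dm" using g2(3) z'(2) by linarith
qed

text \<open>Two opposite Bernoulli inequalities: the numerator grows at least by the factor
  \<alpha>, the denominator at most by \<alpha> exp((\<alpha>-1)s) with s = x+\<sigma>.\<close>

lemma ratio_distortion:
  fixes x \<sigma> :: real
  assumes "\<alpha> > 1" "x > 0" "\<sigma> > 0"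
  shows "(exp x - 1) / (exp (x + \<sigma>) - 1) * exp (- ((\<alpha> - 1) * (x + \<sigma>)))
    \<le> (exp (\<alpha> * x) - 1) / (exp (\<alpha> * (x + \<sigma>)) - 1)"
proof -
  define s where "s = x + \<sigma>"
  have s: "s > 0" using assms by (simp add: s_def)
  have p: "exp s - 1 > 0" "exp (\<alpha> * s) - 1 > 0" "exp x - 1 > 0" using s assms by auto
  have "1 - exp (- (\<alpha> * s)) \<le> \<alpha> * (1 - exp (- s))" using exp_Bernoulli_neg[of \<alpha> s] s assms by simp
  then have "exp (\<alpha> * s) * (1 - exp (- (\<alpha> * s))) \<le> exp (\<alpha> * s) * (\<alpha> * (1 - exp (- s)))"
    by (intro mult_left_mono) auto
  moreover have "exp (\<alpha> * s) * (1 - exp (- (\<alpha> * s))) = exp (\<alpha> * s) - 1"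
    by (simp add: right_diff_distrib flip: exp_add)
  moreover have "exp (\<alpha> * s) * (\<alpha> * (1 - exp (- s))) = \<alpha> * (exp ((\<alpha> - 1) * s) * (exp s - 1))"
    by (simp add: algebra_simps flip: exp_add)
  ultimately have 1: "exp (\<alpha> * s) - 1 \<le> \<alpha> * (exp ((\<alpha> - 1) * s) * (exp s - 1))" by simp
  have "(exp x - 1) / (exp s - 1) * exp (- ((\<alpha> - 1) * s)) = \<alpha> * (exp x - 1) / (\<alpha> * (exp ((\<alpha> - 1) * s) * (exp s - 1)))"
    using assms p by (simp add: exp_minus divide_simps)
  also have "\<dots> \<le> \<alpha> * (exp x - 1) / (exp (\<alpha> * s) - 1)"
    using 1 p assms by (intro divide_left_mono mult_pos_pos) auto
  also have "\<dots> \<le> (exp (\<alpha> * x) - 1) / (exp (\<alpha> * s) - 1)"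
    using p exp_Bernoulli[of \<alpha> x] assms by (intro divide_right_mono) auto
  finally show ?thesis unfolding s_def .
qed

text \<open>The price of a shrinking gap x: it shrinks at most at speed (1 - exp(-x)) r times the
  surplus, while a share 1-r' of the surplus is left to pay. Since (1 - exp(-x)) r = (1-r)(exp
  \<sigma> - 1), \<open>fP_small_gap\<close> yields just the distortion factor of
  \<open>ratio_distortion\<close>.\<close>

lemma distortion_bound:
  fixes x \<sigma> :: real
  assumes "\<alpha> > 1" "x > 0" "\<sigma> > 0" "\<alpha> * (x + \<sigma>) \<le> ln 2"
    and r: "r = (1 - exp (- \<sigma>)) / (1 - exp (- (x + \<sigma>)))"
    and r': "r' = (1 - exp (- (\<alpha> * \<sigma>))) / (1 - exp (- (\<alpha> * (x + \<sigma>))))"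
  shows "fP \<alpha> \<sigma> * ((1 - exp (- x)) * r) \<le> 1 - r'"
proof -
  define s where "s = x + \<sigma>"
  have s: "s > 0" "\<sigma> \<le> s" using assms by (auto simp: s_def)
  have one_minus: "1 - (1 - exp (- v)) / (1 - exp (- (u + v))) = (exp u - 1) / (exp (u + v) - 1)"
    if "u > 0" "v > 0" for u v :: real
  proof -
    define a where "a = exp u"
    define b where "b = exp v"
    have ab: "a > 1" "b > 1" using that by (auto simp: a_def b_def)
    then have "a * b > a" by simp
    then have ab1: "a * b > 1" using ab by linarith
    have e: "exp (u + v) = a * b" "exp (- (u + v)) = 1 / (a * b)" "exp (- v) = 1 / b" "exp u = a"
      by (auto simp: a_def b_def exp_minus exp_add exp_diff field_simps)
    have "1 - 1 / (a * b) = (a * b - 1) / (a * b)" "1 - 1 / b = (b - 1) / b"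
      using ab by (auto simp: field_simps)
    then show ?thesis unfolding e using ab ab1 by (simp add: field_simps)
  qed
  have r1: "1 - r = (exp x - 1) / (exp s - 1)" using one_minus[of x \<sigma>] assms by (simp add: r s_def)
  have "1 - r' = (exp (\<alpha> * x) - 1) / (exp (\<alpha> * s) - 1)"
    using one_minus[of "\<alpha> * x" "\<alpha> * \<sigma>"] assms by (simp add: r' s_def distrib_left)
  then have r1': "(1 - r) * exp (- ((\<alpha> - 1) * s)) \<le> 1 - r'"
    using ratio_distortion[of \<alpha> x \<sigma>] assms r1 by (simp add: s_def)
  have eq: "(1 - exp (- x)) * r = (1 - r) * (exp \<sigma> - 1)"
  proof -
    define a where "a = exp x"
    define b where "b = exp \<sigma>"
    have ab: "a > 1" "b > 1" using assms by (auto simp: a_def b_def)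
    then have "a * b > a" by simp
    then have ab1: "a * b > 1" using ab by linarith
    have e: "exp s = a * b" "exp (- (x + \<sigma>)) = 1 / (a * b)" "exp (- \<sigma>) = 1 / b" "exp x = a" "exp \<sigma> = b" "exp (- x) = 1 / a"
      by (auto simp: a_def b_def s_def exp_minus exp_add exp_diff field_simps)
    have "1 - 1 / (a * b) = (a * b - 1) / (a * b)" "1 - 1 / b = (b - 1) / b" "1 - 1 / a = (a - 1) / a"
      using ab by (auto simp: field_simps)
    then show ?thesis unfolding r1 unfolding r e using ab ab1 by (simp add: field_simps)
  qed
  have P: "0 \<le> fP \<alpha> \<sigma>" "fP \<alpha> \<sigma> \<le> fP \<alpha> s" using fP_ge[of \<alpha> \<sigma>] fP_mono[of \<alpha> \<sigma> s] assms s by auto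
  have r10: "1 - r \<ge> 0" unfolding r1 using s assms by simp
  have "fP \<alpha> \<sigma> * (exp \<sigma> - 1) \<le> fP \<alpha> s * (exp s - 1)"
    using P s assms by (intro mult_mono) auto
  also have "\<dots> = fP \<alpha> s * (exp s - 1) * exp ((\<alpha> - 1) * s) * exp (- ((\<alpha> - 1) * s))"
    by (simp add: exp_minus)
  also have "\<dots> \<le> 1 * exp (- ((\<alpha> - 1) * s))"
    using fP_small_gap[of \<alpha> s] assms s by (intro mult_right_mono) (auto simp: s_def)
  finally have "(1 - r) * (fP \<alpha> \<sigma> * (exp \<sigma> - 1)) \<le> (1 - r) * exp (- ((\<alpha> - 1) * s))"
    using r10 by (intro mult_left_mono) auto
  then show ?thesis using r1' eq by (simp add: mult_ac)
qed

lemma image_rate: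
  "\<alpha> * d\<sigma> / (1 - exp (- (\<alpha> * \<sigma>))) - \<alpha> * dx / (exp (\<alpha> * x) - 1)
    = (d\<sigma> / (1 - exp (- \<sigma>)) - dx / (exp x - 1)) + (fP \<alpha> \<sigma> * d\<sigma> + fR \<alpha> x * dx)"
  unfolding fP_def fR_def by (simp add: algebra_simps)

text \<open>
  Unprimed gaps belong to four consecutive odd points $u < v < v' < w$ (gaps $x$, $m$, $y$ and $\sigma = m + y$),
  primed ones to their images. The last hypothesis, with the extra term on its right-hand side, is the one that
  makes the induction close: it pays for the part of \<open>p4\<close> that comes from the growth of the odd outer gap.
\<close>

lemma block_step:
  fixes \<mu> :: real
  assumes \<alpha>: "\<alpha> > 1" and \<mu>: "\<mu> > 0"
    and pos: "x > 0" "m > 0" "y > 0" "x' > 0" "m' > 0" "y' > 0"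
    and small: "\<alpha> * (x + (m + y)) \<le> ln 2"
    and \<sigma>: "\<sigma> = m + y" "d\<sigma> = dm + dy" "\<sigma>' = m' + y'" "d\<sigma>' = dm' + dy'"
    and p3: "p3 = d\<sigma> / (1 - exp (- \<sigma>)) - dx / (exp x - 1)"
    and p4: "p4 = p3 + (fP \<alpha> \<sigma> * d\<sigma> + fR \<alpha> x * dx)"
      "p4 = d\<sigma>' / (1 - exp (- \<sigma>')) - dx' / (exp x' - 1)"
    and p5: "p5 = p4 + (fP \<alpha> \<sigma>' * d\<sigma>' + fR \<alpha> x' * dx')"
      "p5 = dm / (exp m - 1) - dy / (1 - exp (- y))"
    and p6: "p6 = p5 - (fR \<alpha> m * dm + fP \<alpha> y * dy)"
      "p6 = dm' / (exp m' - 1) - dy' / (1 - exp (- y'))"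
    and p7: "p7 = p6 - (fR \<alpha> m' * dm' + fP \<alpha> y' * dy')"
    and r: "(1 - exp (- (\<alpha> * \<sigma>))) / (1 - exp (- (\<alpha> * (x + \<sigma>)))) = (1 - exp (- \<sigma>')) / (1 - exp (- (x' + \<sigma>')))"
      "(exp m' - 1) / (exp \<sigma>' - 1) \<le> (exp m - 1) / (exp \<sigma> - 1)"
    and inv: "p3 \<ge> \<mu>" "(dx + d\<sigma>) / (1 - exp (- (x + \<sigma>))) \<ge> \<mu>"
      "(dx' + d\<sigma>') / (1 - exp (- (x' + \<sigma>'))) \<ge> \<mu> + fP \<alpha> (x + \<sigma>) * (dx + d\<sigma>)"
  shows "p4 \<ge> \<mu>" "p5 \<ge> \<mu>" "p6 \<ge> \<mu>" "p7 \<ge> \<mu>" "dm / (1 - exp (- m)) \<ge> \<mu>"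
    "dm' / (1 - exp (- m')) \<ge> \<mu> + fP \<alpha> m * dm"
proof -
  define S where "S = (dx + d\<sigma>) / (1 - exp (- (x + \<sigma>)))"
  define S' where "S' = (dx' + d\<sigma>') / (1 - exp (- (x' + \<sigma>')))"
  define z where "z = d\<sigma> / (1 - exp (- \<sigma>))"
  define z' where "z' = d\<sigma>' / (1 - exp (- \<sigma>'))"
  define r3 where "r3 = (1 - exp (- \<sigma>)) / (1 - exp (- (x + \<sigma>)))"
  define r4 where "r4 = (1 - exp (- \<sigma>')) / (1 - exp (- (x' + \<sigma>')))"
  define P where "P = fP \<alpha> \<sigma>"
  define Rx where "Rx = fR \<alpha> x"
  define u where "u = 1 - exp (- x)"
  define u' where "u' = 1 - exp (- x')"
  have \<sigma>pos: "\<sigma> > 0" "\<sigma>' > 0" using pos \<sigma> by auto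
  note g = gap_increase[OF pos(1) \<sigma>pos(1) p3, folded S_def r3_def z_def]
  note g' = gap_increase[OF pos(4) \<sigma>pos(2) p4(2), folded S'_def r4_def z'_def]
  have ss: "x + \<sigma> > 0" "x' + \<sigma>' > 0" using pos \<sigma>pos by auto
  have u: "0 < u" "u < 1" "0 < u'" "u' < 1" using pos by (auto simp: u_def u'_def)
  have S: "S \<ge> \<mu>" using inv by (simp add: S_def)
  have ds: "dx + d\<sigma> = (1 - exp (- (x + \<sigma>))) * S" using ss by (simp add: S_def)
  have ds0: "dx + d\<sigma> \<ge> 0" unfolding ds using S \<mu> ss by auto
  have PP: "(\<alpha> - 1) / 2 \<le> P" "P \<le> fP \<alpha> (x + \<sigma>)" "fP \<alpha> (x + \<sigma>) \<le> \<alpha> - 1"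
    using fP_ge[of \<alpha> \<sigma>] fP_mono[of \<alpha> \<sigma> "x + \<sigma>"] fP_le[of \<alpha> "x + \<sigma>"] \<alpha> pos \<sigma>pos by (auto simp: P_def)
  have Rb: "0 \<le> Rx" "Rx \<le> P" "Rx * u \<le> 1"
    using fR_nonneg[of \<alpha> x] fR_le[of \<alpha> x] fR_bound[of \<alpha> x] \<alpha> pos PP by (auto simp: Rx_def u_def)
  have P0: "P \<ge> 0" using PP \<alpha> by simp
  have dx: "dx = u * (S - r3 * p3)" using g(4) by (simp add: u_def)
  have dx': "dx' = u' * (S' - r4 * p4)" using g'(4) by (simp add: u'_def)
  have z: "z = (1 - u) * S + (1 - (1 - u) * r3) * p3" using g(3) by (simp add: u_def)
  have z': "z' = (1 - u') * S' + (1 - (1 - u') * r4) * p4" using g'(3) by (simp add: u'_def)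
  \<comment> \<open>The coefficients c and 1 - c*q sum to at least 1, so a common lower bound of v
    and w survives; both z and z' have this form.\<close>
  have weight: "c * v + (1 - c * q) * w \<ge> min v w" if "0 \<le> c" "c \<le> 1" "q \<le> 1" "w \<ge> 0" for c q v w :: real
  proof -
    have "(1 - c * q) * w \<ge> (1 - c) * w" using that mult_left_mono[of q 1 c] by (intro mult_right_mono) auto
    moreover have "c * v + (1 - c) * w \<ge> c * min v w + (1 - c) * min v w"
      using that by (intro add_mono mult_left_mono) auto
    ultimately show ?thesis by (simp add: algebra_simps)
  qed
  have z\<mu>: "z \<ge> \<mu>" using weight[of "1 - u" r3 p3 S] u g(2) S inv(1) \<mu> z by (auto simp: min_def split: if_splits)
  have d\<sigma>: "d\<sigma> = (1 - exp (- \<sigma>)) * z" using \<sigma>pos by (simp add: z_def)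
  have d\<sigma>0: "d\<sigma> \<ge> 0" unfolding d\<sigma> using z\<mu> \<mu> \<sigma>pos by auto
  \<comment> \<open>The surplus a and the shrinking speed \<open>dn\<close> of the gap x are the two
    quantities balanced in the rest of the proof.\<close>
  define a where "a = p3 - \<mu>"
  have a: "a \<ge> 0" using inv by (simp add: a_def)
  define dn where "dn = max 0 (- dx)"
  have dn: "0 \<le> dn" "- dx \<le> dn" by (auto simp: dn_def)
  have "r3 * p3 - S \<le> r3 * a"
  proof -
    have "r3 * \<mu> \<le> 1 * \<mu>" using g(2) \<mu> by (intro mult_right_mono) auto
    then show ?thesis using S by (simp add: a_def algebra_simps)
  qed
  then have "- dx \<le> u * (r3 * a)" unfolding dx using u mult_left_mono[of "r3 * p3 - S" "r3 * a" u] by (simp add: algebra_simps)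
  moreover have "0 \<le> u * (r3 * a)" using u g(1) a by simp
  ultimately have dna: "dn \<le> u * r3 * a" by (simp add: dn_def)
  have K: "P * (u * r3) \<le> 1 - r4"
    using distortion_bound[of \<alpha> x \<sigma> r3 r4] \<alpha> pos \<sigma>pos small \<sigma>(1) r(1) by (simp add: P_def u_def r3_def r4_def)
  have Pdn: "P * dn \<le> (1 - r4) * a"
  proof -
    have "P * dn \<le> P * (u * r3 * a)" using dna P0 by (intro mult_left_mono) auto
    also have "\<dots> = P * (u * r3) * a" by simp
    also have "\<dots> \<le> (1 - r4) * a" using K a by (intro mult_right_mono) auto
    finally show ?thesis .
  qed
  have Rdn: "Rx * dn \<le> a"
  proof -
    have "Rx * dn \<le> P * dn" using Rb dn by (intro mult_right_mono) auto
    also have "\<dots> \<le> 1 * a" using Pdn mult_right_mono[of "1 - r4" 1 a] g'(1) a by linarith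
    finally show ?thesis by simp
  qed
  have Rdx: "Rx * dx \<ge> - (Rx * dn)" using mult_left_mono[OF dn(2) Rb(1)] by simp
  \<comment> \<open>Regrouped so that both terms are nonnegative even if dx is negative, because R
    <= P.\<close>
  have "P * d\<sigma> + Rx * dx = Rx * (dx + d\<sigma>) + (P - Rx) * d\<sigma>" by (simp add: algebra_simps)
  then have "P * d\<sigma> + Rx * dx \<ge> 0" using Rb ds0 d\<sigma>0 by simp
  then have p43: "p4 \<ge> p3" using p4(1) by (simp add: P_def Rx_def)
  then show p4\<mu>: "p4 \<ge> \<mu>" using inv by simp
  have S'P: "S' \<ge> \<mu> + P * (dx + d\<sigma>)"
    using inv(3) mult_right_mono[OF PP(2) ds0] by (simp add: S'_def)
  then have S': "S' \<ge> \<mu>" using mult_nonneg_nonneg[OF P0 ds0] by linarith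
  have z'\<mu>: "z' \<ge> \<mu>" using weight[of "1 - u'" r4 p4 S'] u g'(2) S' p4\<mu> \<mu> z' by (auto simp: min_def split: if_splits)
  have ds': "dx' + d\<sigma>' = (1 - exp (- (x' + \<sigma>'))) * S'" using ss by (simp add: S'_def)
  have ds'0: "dx' + d\<sigma>' \<ge> 0" unfolding ds' using S' \<mu> ss by auto
  have d\<sigma>': "d\<sigma>' = (1 - exp (- \<sigma>')) * z'" using \<sigma>pos by (simp add: z'_def)
  have d\<sigma>'0: "d\<sigma>' \<ge> 0" unfolding d\<sigma>' using z'\<mu> \<mu> \<sigma>pos by auto
  have Rb': "0 \<le> fR \<alpha> x'" "fR \<alpha> x' \<le> fP \<alpha> \<sigma>'" "fR \<alpha> x' * u' \<le> 1"
    using fR_nonneg[of \<alpha> x'] fR_le[of \<alpha> x'] fR_bound[of \<alpha> x'] fP_ge[of \<alpha> \<sigma>'] \<alpha> pos \<sigma>pos by (auto simp: u'_def)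
  have "fP \<alpha> \<sigma>' * d\<sigma>' + fR \<alpha> x' * dx' = fR \<alpha> x' * (dx' + d\<sigma>') + (fP \<alpha> \<sigma>' - fR \<alpha> x') * d\<sigma>'" by (simp add: algebra_simps)
  then have p54: "p5 \<ge> p4" using p5(1) Rb' ds'0 d\<sigma>'0 by simp
  then show p5\<mu>: "p5 \<ge> \<mu>" using p4\<mu> by simp
  have "fR \<alpha> m * dm + fP \<alpha> y * dy \<le> P * d\<sigma>"
    using gap_loss[of \<alpha> m y dm dy] \<alpha> pos p5(2) p5\<mu> \<mu> d\<sigma>0 \<sigma> by (simp add: P_def)
  \<comment> \<open>The loss is at most P*d\<sigma>, which was gained in p4; only Rx*dx is left
    over, and the surplus covers it.\<close>
  then have "p6 \<ge> p3 + Rx * dx + (p5 - p4)" using p6(1) p4(1) by (simp add: P_def Rx_def)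
  then have p6a: "p6 \<ge> \<mu> + a + Rx * dx + (p5 - p4)" by (simp add: a_def)
  then show p6\<mu>: "p6 \<ge> \<mu>" using Rdx Rdn p54 by linarith
  have "fR \<alpha> m' * dm' + fP \<alpha> y' * dy' \<le> fP \<alpha> \<sigma>' * d\<sigma>'"
    using gap_loss[of \<alpha> m' y' dm' dy'] \<alpha> pos p6(2) p6\<mu> \<mu> d\<sigma>'0 \<sigma> by simp
  then have p7a: "p7 \<ge> \<mu> + a + Rx * dx + fR \<alpha> x' * dx'" using p7 p6a p5(1) by simp
  have Pds: "P * d\<sigma> = P * (dx + d\<sigma>) - P * dx" by (simp add: algebra_simps)
  have p4S': "p4 - S' \<le> a + (P - Rx) * dn"
  proof -
    have "p4 = \<mu> + a + P * (dx + d\<sigma>) - P * dx + Rx * dx" using p4(1) Pds by (simp add: a_def P_def Rx_def)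
    moreover have "(P - Rx) * (- dx) \<le> (P - Rx) * dn" using dn Rb by (intro mult_left_mono) auto
    ultimately show ?thesis using S'P by (simp add: algebra_simps)
  qed
  \<comment> \<open>In dx' = u'(S' - r4 p4) the outer rate S' offsets most of r4 p4: only the excess
    of p4 over S' counts.\<close>
  have "fR \<alpha> x' * dx' \<ge> - (r4 * (a + (P - Rx) * dn))"
  proof -
    have "r4 * p4 - S' \<le> r4 * (p4 - S')"
      using mult_right_mono[of r4 1 S'] g'(2) S' \<mu> by (simp add: right_diff_distrib)
    also have "\<dots> \<le> r4 * (a + (P - Rx) * dn)" using p4S' g'(1) by (intro mult_left_mono) auto
    finally have le: "r4 * p4 - S' \<le> r4 * (a + (P - Rx) * dn)" .
    have nn: "0 \<le> r4 * (a + (P - Rx) * dn)" using g'(1) a Rb dn by (intro mult_nonneg_nonneg add_nonneg_nonneg) auto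
    have "fR \<alpha> x' * u' * (r4 * p4 - S') \<le> fR \<alpha> x' * u' * (r4 * (a + (P - Rx) * dn))"
      using le Rb' u by (intro mult_left_mono) auto
    also have "\<dots> \<le> 1 * (r4 * (a + (P - Rx) * dn))" using Rb' nn by (intro mult_right_mono) auto
    finally show ?thesis unfolding dx' by (simp add: algebra_simps)
  qed
  moreover have "r4 * ((P - Rx) * dn) \<le> (P - Rx) * dn"
    using g'(1,2) Rb dn mult_right_mono[of r4 1 "(P - Rx) * dn"] by simp
  moreover have "(P - Rx) * dn + Rx * dn = P * dn" by (simp add: algebra_simps)
  \<comment> \<open>The two contributions of \<open>dn\<close> add up to P*dn, and (1-r4)*a of the
    surplus is left: exactly the balance in \<open>Pdn\<close>.\<close>
  ultimately have "p7 \<ge> \<mu> + a - r4 * a - P * dn" using p7a Rdx by (simp add: distrib_left)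
  then show "p7 \<ge> \<mu>" using Pdn by (simp add: left_diff_distrib)
  \<comment> \<open>This is what \<open>contracting_pair\<close> requires of z'. Here z' is a convex
    combination, with weights 1-u' and u', of S' + (1-r4) p4 and p4.\<close>
  have z'T: "z' \<ge> \<mu> + P * d\<sigma>"
  proof -
    have t1: "p4 \<ge> \<mu> + P * d\<sigma>" using p4(1) Rdx Rdn by (simp add: a_def P_def Rx_def)
    have "P * dx \<ge> - (P * dn)" using mult_left_mono[OF dn(2) P0] by simp
    then have t2: "S' \<ge> \<mu> + P * d\<sigma> - P * dn" using S'P by (simp add: distrib_left)
    have "(1 - r4) * p4 \<ge> (1 - r4) * a" using p43 \<mu> g'(2) by (intro mult_left_mono) (auto simp: a_def)
    then have t3: "S' + (1 - r4) * p4 \<ge> \<mu> + P * d\<sigma>" using t2 Pdn by linarith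
    have "z' = (1 - u') * (S' + (1 - r4) * p4) + u' * p4" unfolding z' by (simp add: algebra_simps)
    moreover have "(1 - u') * (S' + (1 - r4) * p4) \<ge> (1 - u') * (\<mu> + P * d\<sigma>)" using t3 u by (intro mult_left_mono) auto
    moreover have "u' * p4 \<ge> u' * (\<mu> + P * d\<sigma>)" using t1 u by (intro mult_left_mono) auto
    ultimately show ?thesis by (simp add: algebra_simps)
  qed
  have "\<alpha> * (m + y) \<le> \<alpha> * (x + (m + y))" using pos \<alpha> by simp
  then have sm: "\<alpha> * (m + y) \<le> ln 2" using small by linarith
  note cp = contracting_pair[OF \<alpha> pos(2,3) sm \<mu>, of z dm dy z' dm' dy' m' y' p5 p6]
  show "dm / (1 - exp (- m)) \<ge> \<mu>" "dm' / (1 - exp (- m')) \<ge> \<mu> + fP \<alpha> m * dm"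
    using cp z\<mu> z'T pos p5(2) p5\<mu> p6 p6\<mu> r(2) \<mu> unfolding z_def z'_def P_def \<sigma> by auto
qed

subsection \<open>The orbit of absolute values\<close>

text \<open>The parameter is $t = |2_a| = a^{\alpha-1} - 1$; odd points are positive and even points are negative.\<close>

fun aorb :: "real \<Rightarrow> real \<Rightarrow> nat \<Rightarrow> real" where
  "aorb \<alpha> t 0 = 0"
| "aorb \<alpha> t (Suc n) =
    (if even n then 1 - (1 + t) * aorb \<alpha> t n powr \<alpha> else (1 + t) * aorb \<alpha> t n powr \<alpha> - 1)"

fun aorb_deriv :: "real \<Rightarrow> real \<Rightarrow> nat \<Rightarrow> real" where
  "aorb_deriv \<alpha> t 0 = 0"
| "aorb_deriv \<alpha> t (Suc n) = (if even n then - 1 else 1) *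
    (aorb \<alpha> t n powr \<alpha> + (1 + t) * (\<alpha> * aorb \<alpha> t n powr (\<alpha> - 1) * aorb_deriv \<alpha> t n))"

declare aorb.simps(2) [simp del] aorb_deriv.simps(2) [simp del]

text \<open>The derivative of $p_{(n+2),n}(n+4)$ with respect to $t$.\<close>

definition pc_deriv :: "real \<Rightarrow> real \<Rightarrow> nat \<Rightarrow> real" where
  "pc_deriv \<alpha> t n =
    (aorb_deriv \<alpha> t (n+4) - aorb_deriv \<alpha> t (n+2)) / (aorb \<alpha> t (n+4) - aorb \<alpha> t (n+2)) -
    (aorb_deriv \<alpha> t n - aorb_deriv \<alpha> t (n+4)) / (aorb \<alpha> t n - aorb \<alpha> t (n+4))"

lemma diff_quot_commute: "(p - q) / (r - s) = (q - p) / (s - r)" for p q r s :: real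
  by (metis minus_diff_eq minus_divide_divide)

text \<open>Splits off the velocity of either endpoint; for two intervals with a common endpoint the
  split-off terms cancel in the difference.\<close>

lemma rate_gap:
  fixes u v u' v' :: real
  assumes "0 < u" "u < v"
  shows "(v' - u') / (v - u) = v' / v + (v' / v - u' / u) / (exp (ln v - ln u) - 1)"
    "(v' - u') / (v - u) = u' / u + (v' / v - u' / u) / (1 - exp (- (ln v - ln u)))"
proof -
  have "exp (ln v - ln u) - 1 = (v - u) / u" "1 - exp (- (ln v - ln u)) = (v - u) / v"
    using assms by (auto simp: exp_diff field_simps)
  moreover have "v' / v + (v' / v - u' / u) / ((v - u) / u) = (v' - u') / (v - u)"
    "u' / u + (v' / v - u' / u) / ((v - u) / v) = (v' - u') / (v - u)"
    using assms by (auto simp: field_simps)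
  ultimately show "(v' - u') / (v - u) = v' / v + (v' / v - u' / u) / (exp (ln v - ln u) - 1)"
    "(v' - u') / (v - u) = u' / u + (v' / v - u' / u) / (1 - exp (- (ln v - ln u)))"
    by simp_all
qed

text \<open>The logarithm of (exp(\<alpha>d) - 1)/(exp d - 1) has derivative P(d) >= 0. This gives
  the decrease of the interval ratio from an odd index to the next even one.\<close>

lemma exp_ratio_mono:
  fixes m s :: real
  assumes "\<alpha> > 1" "0 < m" "m \<le> s"
  shows "(exp (\<alpha> * m) - 1) / (exp (\<alpha> * s) - 1) \<le> (exp m - 1) / (exp s - 1)"
proof -
  have "(\<lambda>d. ln (exp (\<alpha> * d) - 1) - ln (exp d - 1)) m \<le> (\<lambda>d. ln (exp (\<alpha> * d) - 1) - ln (exp d - 1)) s"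
  proof (rule DERIV_nonneg_imp_nondecreasing[OF assms(3)])
    fix x assume "m \<le> x" "x \<le> s"
    then have x: "x > 0" using assms by simp
    have e: "exp x - 1 > 0" "exp (\<alpha> * x) - 1 > 0" using x assms by auto
    have "DERIV (\<lambda>d. ln (exp (\<alpha> * d) - 1) - ln (exp d - 1)) x :>
        exp (\<alpha> * x) * \<alpha> / (exp (\<alpha> * x) - 1) - exp x / (exp x - 1)"
      using e by (auto intro!: derivative_eq_intros)
    moreover have "exp (\<alpha> * x) * \<alpha> / (exp (\<alpha> * x) - 1) - exp x / (exp x - 1) = fP \<alpha> x"
      unfolding fP_def using e x assms by (simp add: exp_minus divide_simps)
    moreover have "fP \<alpha> x \<ge> 0" using fP_ge[of \<alpha> x] x assms by simp
    ultimately show "\<exists>y. DERIV (\<lambda>d. ln (exp (\<alpha> * d) - 1) - ln (exp d - 1)) x :> y \<and> 0 \<le> y" by metis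
  qed
  then have "ln ((exp (\<alpha> * m) - 1) / (exp m - 1)) \<le> ln ((exp (\<alpha> * s) - 1) / (exp s - 1))"
    using assms by (simp add: ln_div)
  moreover have e: "exp m - 1 > 0" "exp s - 1 > 0" "exp (\<alpha> * m) - 1 > 0" "exp (\<alpha> * s) - 1 > 0"
    using assms by auto
  ultimately have "(exp (\<alpha> * m) - 1) / (exp m - 1) \<le> (exp (\<alpha> * s) - 1) / (exp s - 1)" by simp
  then show ?thesis using e by (simp add: divide_simps mult_ac)
qed

section \<open>Range and order of the orbit of absolute values\<close>

locale kneading =
  fixes \<alpha> t :: real
  assumes \<alpha>: "\<alpha> > 1" and t0: "t > 0"
    and E3: "aorb \<alpha> t 3 > 0" and E4: "aorb \<alpha> t 4 > 0"
begin

abbreviation "E \<equiv> aorb \<alpha> t"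
abbreviation "E' \<equiv> aorb_deriv \<alpha> t"
abbreviation "b \<equiv> 1 + t"

lemma E_1: "E (Suc 0) = 1" by (simp add: aorb.simps(2))
lemma E_2: "E 2 = t" using aorb.simps(2)[of \<alpha> t "Suc 0"] by (simp add: E_1 flip: numeral_2_eq_2)
lemma E_3_eq: "E 3 = 1 - b * t powr \<alpha>" using aorb.simps(2)[of \<alpha> t 2] by (simp add: E_2)
lemma E_4_eq: "E 4 = b * E 3 powr \<alpha> - 1" using aorb.simps(2)[of \<alpha> t 3] by simp

lemma t1: "t < 1"
proof (rule ccontr)
  assume "\<not> t < 1"
  then have "1 \<le> t powr \<alpha>" using \<alpha> by (simp add: ge_one_powr_ge_zero)
  then have "1 * 1 \<le> b * t powr \<alpha>" using t0 by (intro mult_mono) auto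
  then show False using E3 E_3_eq by simp
qed

text \<open>The intervals [E 3, 1] and [E 4, t] are mapped into each other, so positivity at 3 and 4
  passes to all later points.\<close>

lemma E_range: "n \<ge> 1 \<Longrightarrow> (if odd n then E 3 \<le> E n \<and> E n \<le> 1 else E 4 \<le> E n \<and> E n \<le> t)"
proof (induction n)
  case 0 then show ?case by simp
next
  case (Suc n)
  show ?case
  proof (cases "n = 0")
    case True
    then show ?thesis using E_3_eq t0 E_1 by simp
  next
    case False
    then have IH: "if odd n then E 3 \<le> E n \<and> E n \<le> 1 else E 4 \<le> E n \<and> E n \<le> t" using Suc by simp
    show ?thesis
    proof (cases "odd n")
      case True
      then have r: "E 3 \<le> E n" "E n \<le> 1" using IH by auto
      then have "E 3 powr \<alpha> \<le> E n powr \<alpha>" "E n powr \<alpha> \<le> 1"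
        using E3 \<alpha> powr_mono2[of \<alpha> "E n" 1] by (auto intro!: powr_mono2)
      then have "b * E 3 powr \<alpha> \<le> b * E n powr \<alpha>" "b * E n powr \<alpha> \<le> b * 1"
        using t0 by (auto intro!: mult_left_mono)
      then show ?thesis using True E_4_eq by (simp add: aorb.simps(2))
    next
      case ev: False
      then have r: "E 4 \<le> E n" "E n \<le> t" using IH by auto
      then have "E n powr \<alpha> \<le> t powr \<alpha>" using E4 \<alpha> by (auto intro!: powr_mono2)
      then have "b * E n powr \<alpha> \<le> b * t powr \<alpha>" using t0 by (auto intro!: mult_left_mono)
      moreover have "0 \<le> b * E n powr \<alpha>" using t0 by simp
      ultimately show ?thesis using ev E_3_eq by (simp add: aorb.simps(2))
    qed
  qed
qed

lemma E_pos: "n \<ge> 1 \<Longrightarrow> E n > 0"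
  using E_range[of n] E3 E4 by (auto split: if_splits)

lemma E_nonneg: "E n \<ge> 0"
  using E_pos[of n] by (cases "n = 0") auto

lemma E_step_less:
  assumes "E i < E j" "even i = even j"
  shows "if even i then E (Suc j) < E (Suc i) else E (Suc i) < E (Suc j)"
proof -
  have "E i powr \<alpha> < E j powr \<alpha>" using assms E_nonneg \<alpha> by (intro powr_less_mono2) auto
  then have "b * E i powr \<alpha> < b * E j powr \<alpha>" using t0 by simp
  then show ?thesis using assms(2) by (simp add: aorb.simps(2))
qed

text \<open>The indices for which E n is the smallest of the three points. In absolute values an
  even step reverses order and an odd step preserves it, hence the period four.\<close>

definition expanding :: "nat \<Rightarrow> bool" where
  "expanding n \<longleftrightarrow> n mod 4 = 0 \<or> n mod 4 = 3"

lemma E_order: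
  "if expanding n then E n < E (n+4) \<and> E (n+4) < E (n+2)
   else E (n+2) < E (n+4) \<and> E (n+4) < E n"
proof (induction n)
  case 0
  have "E 3 powr \<alpha> < 1"
  proof -
    have "E 3 < 1" using E_3_eq t0 by simp
    then have "E 3 powr \<alpha> < 1 powr \<alpha>" using E3 \<alpha> by (intro powr_less_mono2) auto
    then show ?thesis by simp
  qed
  then have "b * E 3 powr \<alpha> < b * 1" using t0 by (intro mult_strict_left_mono) auto
  then have "E 4 < t" using E_4_eq by simp
  then show ?case using E4 E_2 by (simp add: expanding_def numeral_2_eq_2)
next
  case (Suc n)
  have eq: "Suc n + 4 = Suc (n + 4)" "Suc n + 2 = Suc (n + 2)" by auto
  have par: "even (n + 4) = even n" "even (n + 2) = even n" by auto
  consider "n mod 4 = 0" | "n mod 4 = 1" | "n mod 4 = 2" | "n mod 4 = 3" by linarith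
  then show ?case
  proof cases
    case 1
    then have "even n" "expanding n" "\<not> expanding (Suc n)" unfolding expanding_def by presburger+
    then show ?thesis
      using Suc E_step_less[of n "n+4"] E_step_less[of "n+4" "n+2"] unfolding eq by simp
  next
    case 2
    then have "odd n" "\<not> expanding n" "\<not> expanding (Suc n)" unfolding expanding_def by presburger+
    then show ?thesis
      using Suc E_step_less[of "n+2" "n+4"] E_step_less[of "n+4" n] unfolding eq by simp
  next
    case 3
    then have "even n" "\<not> expanding n" "expanding (Suc n)" unfolding expanding_def by presburger+
    then show ?thesis
      using Suc E_step_less[of "n+2" "n+4"] E_step_less[of "n+4" n] unfolding eq by simp
  next
    case 4
    then have "odd n" "expanding n" "expanding (Suc n)" unfolding expanding_def by presburger+
    then show ?thesis
      using Suc E_step_less[of n "n+4"] E_step_less[of "n+4" "n+2"] unfolding eq by simp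
  qed
qed

section \<open>Logarithmic coordinates and their velocities along the orbit\<close>

definition "Y n = ln (E n)"
definition "V n = E' n / E n"

lemma rate_image:
  assumes "i \<ge> 1" "j \<ge> 1" "E i < E j" "even i = even j"
  shows "(E' (Suc j) - E' (Suc i)) / (E (Suc j) - E (Suc i))
      = 1 / b + \<alpha> * V j + \<alpha> * (V j - V i) / (exp (\<alpha> * (Y j - Y i)) - 1)"
    "(E' (Suc j) - E' (Suc i)) / (E (Suc j) - E (Suc i))
      = 1 / b + \<alpha> * V i + \<alpha> * (V j - V i) / (1 - exp (- (\<alpha> * (Y j - Y i))))"
proof -
  have pos: "E i > 0" "E j > 0" using E_pos assms by auto
  define u where "u = E i powr \<alpha>"
  define v where "v = E j powr \<alpha>"
  have uv: "0 < u" "u < v" using pos assms \<alpha> by (auto simp: u_def v_def intro: powr_less_mono2)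
  have d: "\<alpha> * E i powr (\<alpha> - 1) * E' i = \<alpha> * (u * V i)" "\<alpha> * E j powr (\<alpha> - 1) * E' j = \<alpha> * (v * V j)"
    using pos by (auto simp: u_def v_def V_def powr_diff)
  have "(E' (Suc j) - E' (Suc i)) / (E (Suc j) - E (Suc i))
      = ((v - u) + b * (\<alpha> * (v * V j) - \<alpha> * (u * V i))) / (b * (v - u))"
    (is "?l = _")
  proof (cases "even i")
    case True
    then have "E' (Suc j) - E' (Suc i) = - ((v - u) + b * (\<alpha> * (v * V j) - \<alpha> * (u * V i)))"
      "E (Suc j) - E (Suc i) = - (b * (v - u))"
      using assms(4) unfolding aorb_deriv.simps aorb.simps d by (auto simp: u_def v_def right_diff_distrib)
    then show ?thesis by (simp only: minus_divide_divide)
  next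
    case False
    then have "E' (Suc j) - E' (Suc i) = ((v - u) + b * (\<alpha> * (v * V j) - \<alpha> * (u * V i)))"
      "E (Suc j) - E (Suc i) = (b * (v - u))"
      using assms(4) unfolding aorb_deriv.simps aorb.simps d by (auto simp: u_def v_def right_diff_distrib)
    then show ?thesis by (simp only:)
  qed
  also have "\<dots> = 1 / b + (\<alpha> * (v * V j) - \<alpha> * (u * V i)) / (v - u)"
    using uv t0 by (simp add: add_divide_distrib)
  finally have l: "?l = 1 / b + (\<alpha> * (v * V j) - \<alpha> * (u * V i)) / (v - u)" .
  have ln: "ln v - ln u = \<alpha> * (Y j - Y i)" using pos by (simp add: u_def v_def Y_def ln_powr right_diff_distrib)
  have dd: "\<alpha> * (v * V j) / v = \<alpha> * V j" "\<alpha> * (u * V i) / u = \<alpha> * V i" using uv by auto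
  show "?l = 1 / b + \<alpha> * V j + \<alpha> * (V j - V i) / (exp (\<alpha> * (Y j - Y i)) - 1)"
    using l rate_gap(1)[OF uv, of "\<alpha> * (v * V j)" "\<alpha> * (u * V i)"] unfolding ln dd by (simp add: right_diff_distrib)
  show "?l = 1 / b + \<alpha> * V i + \<alpha> * (V j - V i) / (1 - exp (- (\<alpha> * (Y j - Y i))))"
    using l rate_gap(2)[OF uv, of "\<alpha> * (v * V j)" "\<alpha> * (u * V i)"] unfolding ln dd by (simp add: right_diff_distrib)
qed

lemma rate_log:
  assumes "i \<ge> 1" "j \<ge> 1" "E i < E j"
  shows "(E' j - E' i) / (E j - E i) = V j + (V j - V i) / (exp (Y j - Y i) - 1)"
    "(E' j - E' i) / (E j - E i) = V i + (V j - V i) / (1 - exp (- (Y j - Y i)))"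
  using rate_gap[of "E i" "E j" "E' j" "E' i"] E_pos[of i] assms by (auto simp: V_def Y_def)

abbreviation "p' \<equiv> pc_deriv \<alpha> t"

lemma pc_deriv_expanding:
  assumes "n \<ge> 1" "expanding n"
  shows "p' n = (V (n+2) - V (n+4)) / (1 - exp (- (Y (n+2) - Y (n+4))))
      - (V (n+4) - V n) / (exp (Y (n+4) - Y n) - 1)" (is ?A)
    "p' (Suc n) = p' n + (fP \<alpha> (Y (n+2) - Y (n+4)) * (V (n+2) - V (n+4)) + fR \<alpha> (Y (n+4) - Y n) * (V (n+4) - V n))"
proof -
  have o: "E n < E (n+4)" "E (n+4) < E (n+2)" using E_order[of n] assms by auto
  have Y: "Y (n+4) - Y n > 0" "Y (n+2) - Y (n+4) > 0" using o E_pos[of n] assms by (auto simp: Y_def)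
  have 1: "p' n = (E' (n+2) - E' (n+4)) / (E (n+2) - E (n+4)) - (E' (n+4) - E' n) / (E (n+4) - E n)"
    unfolding pc_deriv_def by (metis diff_quot_commute)
  show A: ?A unfolding 1
    using rate_log(2)[of "n+4" "n+2"] rate_log(1)[of n "n+4"] o assms by simp
  have 2: "p' (Suc n) = (E' (Suc (n+2)) - E' (Suc (n+4))) / (E (Suc (n+2)) - E (Suc (n+4)))
      - (E' (Suc (n+4)) - E' (Suc n)) / (E (Suc (n+4)) - E (Suc n))"
    unfolding pc_deriv_def by (metis diff_quot_commute add_Suc)
  have "p' (Suc n) = \<alpha> * (V (n+2) - V (n+4)) / (1 - exp (- (\<alpha> * (Y (n+2) - Y (n+4)))))
      - \<alpha> * (V (n+4) - V n) / (exp (\<alpha> * (Y (n+4) - Y n)) - 1)"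
    unfolding 2 using rate_image(2)[of "n+4" "n+2"] rate_image(1)[of n "n+4"] o assms by simp
  then show "p' (Suc n) = p' n + (fP \<alpha> (Y (n+2) - Y (n+4)) * (V (n+2) - V (n+4)) + fR \<alpha> (Y (n+4) - Y n) * (V (n+4) - V n))"
    unfolding A using image_rate[of \<alpha> "V (n+2) - V (n+4)" "Y (n+2) - Y (n+4)" "V (n+4) - V n" "Y (n+4) - Y n"]
    by simp
qed

lemma pc_deriv_contracting:
  assumes "n \<ge> 1" "\<not> expanding n"
  shows "p' n = (V (n+4) - V (n+2)) / (exp (Y (n+4) - Y (n+2)) - 1)
      - (V n - V (n+4)) / (1 - exp (- (Y n - Y (n+4))))" (is ?A)
    "p' (Suc n) = p' n - (fR \<alpha> (Y (n+4) - Y (n+2)) * (V (n+4) - V (n+2)) + fP \<alpha> (Y n - Y (n+4)) * (V n - V (n+4)))"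
proof -
  have o: "E (n+2) < E (n+4)" "E (n+4) < E n" using E_order[of n] assms by auto
  have Y: "Y (n+4) - Y (n+2) > 0" "Y n - Y (n+4) > 0" using o E_pos[of n] E_pos[of "n+2"] E_pos[of "n+4"] assms by (auto simp: Y_def)
  show A: ?A unfolding pc_deriv_def
    using rate_log(1)[of "n+2" "n+4"] rate_log(2)[of "n+4" n] o assms by simp
  have 2: "p' (Suc n) = (E' (Suc (n+4)) - E' (Suc (n+2))) / (E (Suc (n+4)) - E (Suc (n+2)))
      - (E' (Suc n) - E' (Suc (n+4))) / (E (Suc n) - E (Suc (n+4)))"
    unfolding pc_deriv_def by simp
  have "p' (Suc n) = \<alpha> * (V (n+4) - V (n+2)) / (exp (\<alpha> * (Y (n+4) - Y (n+2))) - 1)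
      - \<alpha> * (V n - V (n+4)) / (1 - exp (- (\<alpha> * (Y n - Y (n+4)))))"
    unfolding 2 using rate_image(1)[of "n+2" "n+4"] rate_image(2)[of "n+4" n] o assms by simp
  then show "p' (Suc n) = p' n - (fR \<alpha> (Y (n+4) - Y (n+2)) * (V (n+4) - V (n+2)) + fP \<alpha> (Y n - Y (n+4)) * (V n - V (n+4)))"
    unfolding A using image_rate[of \<alpha> "V n - V (n+4)" "Y n - Y (n+4)" "V (n+4) - V (n+2)" "Y (n+4) - Y (n+2)"]
    by simp
qed

text \<open>E 4 > 0 means (1+t)(E 3)^\<alpha> > 1, and 1+t < 2; so \<alpha> ln(E 3) > -ln 2, while
  all odd points lie in [E 3, 1].\<close>

lemma Y_le_ln2: "odd i \<Longrightarrow> odd j \<Longrightarrow> \<alpha> * (Y j - Y i) \<le> ln 2"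
proof -
  assume ij: "odd i" "odd j"
  have "i \<ge> 1" "j \<ge> 1" using ij odd_pos[of i] odd_pos[of j] by auto
  then have i: "E 3 \<le> E i" and j: "E j \<le> 1" "E j > 0"
    using E_range[of i] E_range[of j] E_pos[of j] ij by auto
  have "1 < b * E 3 powr \<alpha>" using E4 E_4_eq by simp
  also have "\<dots> \<le> 2 * E 3 powr \<alpha>" using t1 by (intro mult_right_mono) auto
  finally have "1 / 2 < E 3 powr \<alpha>" by simp
  then have "ln (1 / 2) < ln (E 3 powr \<alpha>)" using E3 by (subst ln_less_cancel_iff) auto
  then have "- ln 2 < \<alpha> * ln (E 3)" using E3 by (simp add: ln_powr ln_div)
  moreover have "\<alpha> * ln (E 3) \<le> \<alpha> * Y i" using i E3 \<alpha> by (auto simp: Y_def)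
  moreover have "\<alpha> * Y j \<le> 0" using j \<alpha> by (auto simp: Y_def intro: mult_nonneg_nonpos)
  ultimately show ?thesis by (simp add: right_diff_distrib)
qed

lemma exp_gap: assumes "i \<ge> 1" "j \<ge> 1"
  shows "exp (\<alpha> * (Y j - Y i)) = E j powr \<alpha> / E i powr \<alpha>" "exp (Y j - Y i) = E j / E i"
  using E_pos[of i] E_pos[of j] assms
  by (auto simp: Y_def powr_def right_diff_distrib exp_diff)

text \<open>From an odd index the map is affine in E^\<alpha>, and affine maps preserve ratios of
  intervals.\<close>

lemma image_ratio:
  assumes "i \<ge> 1" "j \<ge> 1" "k \<ge> 1" "odd i" "odd j" "odd k" "E i \<noteq> E j"
  shows "(exp (\<alpha> * (Y k - Y i)) - 1) / (exp (\<alpha> * (Y j - Y i)) - 1)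
    = (exp (Y (Suc k) - Y (Suc i)) - 1) / (exp (Y (Suc j) - Y (Suc i)) - 1)"
proof -
  have p: "E i > 0" "E j > 0" "E k > 0" "E (Suc i) > 0"
    using E_pos[of i] E_pos[of j] E_pos[of k] E_pos[of "Suc i"] assms by auto
  have "(exp (\<alpha> * (Y k - Y i)) - 1) / (exp (\<alpha> * (Y j - Y i)) - 1)
    = (E k powr \<alpha> - E i powr \<alpha>) / (E j powr \<alpha> - E i powr \<alpha>)"
  proof -
    have "E k powr \<alpha> / E i powr \<alpha> - 1 = (E k powr \<alpha> - E i powr \<alpha>) / E i powr \<alpha>"
      "E j powr \<alpha> / E i powr \<alpha> - 1 = (E j powr \<alpha> - E i powr \<alpha>) / E i powr \<alpha>"
      using p by (auto simp: field_simps)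
    then show ?thesis using exp_gap assms p by simp
  qed
  moreover have "(exp (Y (Suc k) - Y (Suc i)) - 1) / (exp (Y (Suc j) - Y (Suc i)) - 1)
    = (E (Suc k) - E (Suc i)) / (E (Suc j) - E (Suc i))"
  proof -
    have "E (Suc k) / E (Suc i) - 1 = (E (Suc k) - E (Suc i)) / E (Suc i)"
      "E (Suc j) / E (Suc i) - 1 = (E (Suc j) - E (Suc i)) / E (Suc i)"
      using p by (auto simp: field_simps)
    then show ?thesis using exp_gap(2)[of "Suc i" "Suc k"] exp_gap(2)[of "Suc i" "Suc j"] p by simp
  qed
  moreover have "E (Suc k) - E (Suc i) = b * (E k powr \<alpha> - E i powr \<alpha>)"
    "E (Suc j) - E (Suc i) = b * (E j powr \<alpha> - E i powr \<alpha>)"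
    using assms by (auto simp: right_diff_distrib aorb.simps(2))
  ultimately show ?thesis using t0 by simp
qed

end

section \<open>The first indices and the induction over blocks\<close>

context kneading
begin

lemma Y_1: "Y (Suc 0) = 0" by (simp add: Y_def E_1)

text \<open>Index 0 is separate because E 0 = 0 has no logarithm. It behaves like an infinite gap:
  the R term disappears, and the quotient that involves E 0 is just the common summand that
  cancels.\<close>

lemma pc_deriv_0:
  "p' 0 = (V 2 - V 4) / (1 - exp (- (Y 2 - Y 4)))" (is ?A)
  "p' 1 = p' 0 + fP \<alpha> (Y 2 - Y 4) * (V 2 - V 4)"
proof -
  have o: "0 < E 4" "E 4 < E 2" using E_order[of 0] by (auto simp: expanding_def numeral_2_eq_2)
  have A1: "(E' 4 - E' 2) / (E 4 - E 2) = (E' 2 - E' 4) / (E 2 - E 4)" by (rule diff_quot_commute)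
  have "p' 0 = (E' 4 - E' 2) / (E 4 - E 2) - (E' 0 - E' 4) / (E 0 - E 4)"
    by (simp add: pc_deriv_def numeral_2_eq_2)
  also have "\<dots> = (V 2 - V 4) / (1 - exp (- (Y 2 - Y 4)))"
    unfolding A1 using rate_log(2)[of 4 2] o by (simp add: V_def)
  finally show A: ?A .
  have "p' 1 = (E' 5 - E' 3) / (E 5 - E 3) - (E' 1 - E' 5) / (E 1 - E 5)"
    by (simp add: pc_deriv_def numeral_3_eq_3)
  moreover have "(E' 5 - E' 3) / (E 5 - E 3) = (E' (Suc 2) - E' (Suc 4)) / (E (Suc 2) - E (Suc 4))"
    using diff_quot_commute by simp
  moreover have "\<dots> = 1 / b + \<alpha> * V 4 + \<alpha> * (V 2 - V 4) / (1 - exp (- (\<alpha> * (Y 2 - Y 4))))"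
    using rate_image(2)[of 4 2] o by simp
  moreover have "(E' 1 - E' 5) / (E 1 - E 5) = 1 / b + \<alpha> * V 4"
  proof -
    have "E 5 = 1 - b * E 4 powr \<alpha>" "E' 5 = - (E 4 powr \<alpha> + b * (\<alpha> * E 4 powr (\<alpha> - 1) * E' 4))"
      using aorb.simps(2)[of \<alpha> t 4] aorb_deriv.simps(2)[of \<alpha> t 4] by simp_all
    moreover have "\<alpha> * E 4 powr (\<alpha> - 1) * E' 4 = E 4 powr \<alpha> * (\<alpha> * V 4)"
      using o by (simp add: V_def powr_diff)
    ultimately have "(E' 1 - E' 5) / (E 1 - E 5) = (E 4 powr \<alpha> + b * (E 4 powr \<alpha> * (\<alpha> * V 4))) / (b * E 4 powr \<alpha>)"
      by (simp add: E_1 aorb_deriv.simps(2))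
    then show ?thesis using o t0 by (simp add: add_divide_distrib)
  qed
  ultimately have "p' 1 = \<alpha> * (V 2 - V 4) / (1 - exp (- (\<alpha> * (Y 2 - Y 4))))" by simp
  then show "p' 1 = p' 0 + fP \<alpha> (Y 2 - Y 4) * (V 2 - V 4)"
    unfolding A fP_def by (simp add: algebra_simps)
qed

lemma Y_less: "i \<ge> 1 \<Longrightarrow> E i < E j \<Longrightarrow> Y i < Y j"
  using E_pos[of i] by (simp add: Y_def)

text \<open>The gain at index 0 pays for the loss at index 2. The loss at index 1 is at most
  (\<alpha>-1)(V 1 - V 3), the excess demanded of p' 0. The bounds at and beyond index 3 start the
  block induction.\<close>

lemma initial_steps:
  assumes \<mu>: "\<mu> > 0"
    and Z: "(V 1 - V 3) / (1 - exp (- (Y 1 - Y 3))) \<ge> \<mu>"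
    and p0: "p' 0 \<ge> \<mu> + (\<alpha> - 1) * (V 1 - V 3)"
  shows "p' 0 \<ge> \<mu>" "p' 1 \<ge> \<mu>" "p' 2 \<ge> \<mu>" "p' 3 \<ge> \<mu>"
    "(V 5 - V 3) / (1 - exp (- (Y 5 - Y 3))) \<ge> \<mu>"
    "(V 6 - V 4) / (1 - exp (- (Y 6 - Y 4))) \<ge> \<mu> + fP \<alpha> (Y 5 - Y 3) * (V 5 - V 3)"
proof -
  have n: "\<not> expanding 1" "\<not> expanding 2" by (auto simp: expanding_def)
  have o1: "E 3 < E 5" "E 5 < E 1" using E_order[of 1] n by (auto simp: numeral_3_eq_3)
  have o2: "E 4 < E 6" "E 6 < E 2" using E_order[of 2] n by auto
  have Y1: "Y 3 < Y 5" "Y 5 < Y 1" using o1 Y_less by auto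
  have Y2: "Y 4 < Y 6" "Y 6 < Y 2" using o2 Y_less by auto
  have c1: "p' 1 = (V 5 - V 3) / (exp (Y 5 - Y 3) - 1) - (V 1 - V 5) / (1 - exp (- (Y 1 - Y 5)))"
    "p' 2 = p' 1 - (fR \<alpha> (Y 5 - Y 3) * (V 5 - V 3) + fP \<alpha> (Y 1 - Y 5) * (V 1 - V 5))"
    using pc_deriv_contracting[of 1] n by (simp_all add: numeral_2_eq_2 numeral_3_eq_3)
  have c2: "p' 2 = (V 6 - V 4) / (exp (Y 6 - Y 4) - 1) - (V 2 - V 6) / (1 - exp (- (Y 2 - Y 6)))"
    "p' 3 = p' 2 - (fR \<alpha> (Y 6 - Y 4) * (V 6 - V 4) + fP \<alpha> (Y 2 - Y 6) * (V 2 - V 6))"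
    using pc_deriv_contracting[of 2] n by simp_all
  have s: "Y 1 - Y 3 > 0" using Y1 by simp
  have e1: "1 - exp (- (Y 1 - Y 3)) > 0" using s by simp
  have ds: "V 1 - V 3 \<ge> 0" using Z \<mu> e1 by (metis less_le_trans less_imp_le zero_less_divide_iff less_asym)
  have P1: "0 \<le> fP \<alpha> (Y 1 - Y 3)" "fP \<alpha> (Y 1 - Y 3) \<le> \<alpha> - 1"
    using fP_ge[of \<alpha> "Y 1 - Y 3"] fP_le[of \<alpha> "Y 1 - Y 3"] \<alpha> s by auto
  have P1ds: "fP \<alpha> (Y 1 - Y 3) * (V 1 - V 3) \<le> (\<alpha> - 1) * (V 1 - V 3)"
    "0 \<le> fP \<alpha> (Y 1 - Y 3) * (V 1 - V 3)"
    using P1 ds by (auto intro: mult_right_mono)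
  show p0\<mu>: "p' 0 \<ge> \<mu>" using p0 P1ds by linarith
  have "Y 2 - Y 4 > 0" using Y2 by simp
  then have e2: "1 - exp (- (Y 2 - Y 4)) > 0" and P2: "0 \<le> fP \<alpha> (Y 2 - Y 4)"
    using fP_ge[of \<alpha> "Y 2 - Y 4"] \<alpha> by auto
  have ds2: "V 2 - V 4 \<ge> 0" using p0\<mu> \<mu> e2 pc_deriv_0(1)
    by (metis less_le_trans less_imp_le zero_less_divide_iff less_asym)
  have p1: "p' 1 \<ge> p' 0" using pc_deriv_0(2) P2 ds2 by simp
  then show p1\<mu>: "p' 1 \<ge> \<mu>" using p0\<mu> by simp
  have l1: "fR \<alpha> (Y 5 - Y 3) * (V 5 - V 3) + fP \<alpha> (Y 1 - Y 5) * (V 1 - V 5) \<le> fP \<alpha> (Y 1 - Y 3) * (V 1 - V 3)"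
    using gap_loss[of \<alpha> "Y 5 - Y 3" "Y 1 - Y 5" "V 5 - V 3" "V 1 - V 5"] \<alpha> Y1 c1(1) p1\<mu> \<mu> ds by simp
  then show p2\<mu>: "p' 2 \<ge> \<mu>" using c1(2) p1 p0 P1ds by linarith
  have "fR \<alpha> (Y 6 - Y 4) * (V 6 - V 4) + fP \<alpha> (Y 2 - Y 6) * (V 2 - V 6) \<le> fP \<alpha> (Y 2 - Y 4) * (V 2 - V 4)"
    using gap_loss[of \<alpha> "Y 6 - Y 4" "Y 2 - Y 6" "V 6 - V 4" "V 2 - V 6"] \<alpha> Y2 c2(1) p2\<mu> \<mu> ds2 by simp
  then show "p' 3 \<ge> \<mu>" using c2(2) c1(2) l1 pc_deriv_0(2) p0 P1ds by linarith
  have r: "(exp (Y 6 - Y 4) - 1) / (exp (Y 2 - Y 4) - 1) \<le> (exp (Y 5 - Y 3) - 1) / (exp (Y 1 - Y 3) - 1)"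
    using image_ratio[of 3 1 5] exp_ratio_mono[of \<alpha> "Y 5 - Y 3" "Y 1 - Y 3"] \<alpha> Y1 o1
    by (simp flip: numeral_2_eq_2)
  have sm: "\<alpha> * (Y 1 - Y 3) \<le> ln 2" using Y_le_ln2[of 3 1] by simp
  note cp = contracting_pair[OF \<alpha>, of "Y 5 - Y 3" "Y 1 - Y 5" \<mu>
      "(V 1 - V 3) / (1 - exp (- (Y 1 - Y 3)))" "V 5 - V 3" "V 1 - V 5"
      "p' 0" "V 6 - V 4" "V 2 - V 6" "Y 6 - Y 4" "Y 2 - Y 6" "p' 1" "p' 2"]
  have z': "p' 0 \<ge> \<mu> + fP \<alpha> (Y 1 - Y 3) * (V 1 - V 3)" using p0 P1ds by linarith
  have sums: "Y 5 - Y 3 + (Y 1 - Y 5) = Y 1 - Y 3" "V 5 - V 3 + (V 1 - V 5) = V 1 - V 3"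
    "Y 6 - Y 4 + (Y 2 - Y 6) = Y 2 - Y 4" "V 6 - V 4 + (V 2 - V 6) = V 2 - V 4" by simp_all
  have pos: "0 < Y 5 - Y 3" "0 < Y 1 - Y 5" "0 < Y 6 - Y 4" "0 < Y 2 - Y 6" using Y1 Y2 by simp_all
  have nn: "p' 1 \<ge> 0" "p' 2 \<ge> 0" using p1\<mu> p2\<mu> \<mu> by simp_all
  note cp' = cp[unfolded sums, OF pos(1,2) sm \<mu> refl Z pc_deriv_0(1) z' pos(3,4) c1(1) nn(1) c1(2) c2(1) nn(2) r]
  show "(V 5 - V 3) / (1 - exp (- (Y 5 - Y 3))) \<ge> \<mu>" by (rule cp'(1))
  show "(V 6 - V 4) / (1 - exp (- (Y 6 - Y 4))) \<ge> \<mu> + fP \<alpha> (Y 5 - Y 3) * (V 5 - V 3)" by (rule cp'(2))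
qed

text \<open>Meant for k congruent to 3 modulo 4: k and k+2 bound the outer gap among odd points, k+1
  and k+3 its image. The constant \<mu> stays free, as the induction uses only its
  positivity.\<close>

definition "block_inv \<mu> k \<longleftrightarrow> p' k \<ge> \<mu> \<and>
  (V (k+2) - V k) / (1 - exp (- (Y (k+2) - Y k))) \<ge> \<mu> \<and>
  (V (k+3) - V (k+1)) / (1 - exp (- (Y (k+3) - Y (k+1))))
    \<ge> \<mu> + fP \<alpha> (Y (k+2) - Y k) * (V (k+2) - V k)"

lemma block_inv_step:
  assumes \<mu>: "\<mu> > 0" and k: "k mod 4 = 3" and inv: "block_inv \<mu> k"
  shows "block_inv \<mu> (k+4)" "p' (k+1) \<ge> \<mu>" "p' (k+2) \<ge> \<mu>" "p' (k+3) \<ge> \<mu>"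
proof -
  have k1: "k \<ge> 1" using k by (cases k) auto
  have x: "expanding k" "expanding (k+1)" "\<not> expanding (k+2)" "\<not> expanding (k+3)" "odd k"
    using k unfolding expanding_def by presburger+
  have a: "k + 1 + 2 = k + 3" "k + 1 + 4 = k + 5" "k + 2 + 2 = k + 4" "k + 2 + 4 = k + 6"
     "k + 3 + 2 = k + 5" "k + 3 + 4 = k + 7" "Suc k = k + 1" "Suc (k + 1) = k + 2" "Suc (k + 2) = k + 3" "Suc (k + 3) = k + 4"
    by auto
  have o: "E k < E (k+4)" "E (k+4) < E (k+6)" "E (k+6) < E (k+2)"
    "E (k+1) < E (k+5)" "E (k+5) < E (k+7)" "E (k+7) < E (k+3)"
    using E_order[of k] E_order[of "k+1", unfolded a] E_order[of "k+2", unfolded a] E_order[of "k+3", unfolded a] x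
    by simp_all
  have YY: "Y k < Y (k+4)" "Y (k+4) < Y (k+6)" "Y (k+6) < Y (k+2)"
    "Y (k+1) < Y (k+5)" "Y (k+5) < Y (k+7)" "Y (k+7) < Y (k+3)"
    using o Y_less k1 by auto
  note q0 = pc_deriv_expanding[OF k1 x(1), unfolded a]
  have "k + 1 \<ge> 1" "k + 2 \<ge> 1" "k + 3 \<ge> 1" by auto
  note q1 = pc_deriv_expanding[OF this(1) x(2), unfolded a]
    and q2 = pc_deriv_contracting[OF this(2) x(3), unfolded a]
    and q3 = pc_deriv_contracting[OF this(3) x(4), unfolded a]
  have sm: "\<alpha> * (Y (k+2) - Y k) \<le> ln 2" using Y_le_ln2[of k "k+2"] x by simp
  have neg: "(1 - exp (- (c * (y1 - y2)))) / (1 - exp (- (c * (y1 - y3)))) =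
     (exp (c * (y2 - y1)) - 1) / (exp (c * (y3 - y1)) - 1)" for c y1 y2 y3 :: real
  proof -
    have "- (c * (y1 - y2)) = c * (y2 - y1)" "- (c * (y1 - y3)) = c * (y3 - y1)" by (auto simp: algebra_simps)
    then have "(1 - exp (- (c * (y1 - y2)))) / (1 - exp (- (c * (y1 - y3)))) =
      (1 - exp (c * (y2 - y1))) / (1 - exp (c * (y3 - y1)))" by simp
    also have "\<dots> = (exp (c * (y2 - y1)) - 1) / (exp (c * (y3 - y1)) - 1)" by (rule diff_quot_commute)
    finally show ?thesis .
  qed
  have r1: "(1 - exp (- (\<alpha> * (Y (k+2) - Y (k+4))))) / (1 - exp (- (\<alpha> * (Y (k+2) - Y k))))
    = (1 - exp (- (Y (k+3) - Y (k+5)))) / (1 - exp (- (Y (k+3) - Y (k+1))))"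
  proof -
    have "k + 2 \<ge> 1" "k + 4 \<ge> 1" "odd (k + 2)" "odd (k + 4)" "E (k+2) \<noteq> E k" using x(5) o by auto
    note image_ratio[OF this(1) k1 this(2,3) x(5) this(4,5)]
    moreover have "Suc (k + 2) = k + 3" "Suc (k + 4) = k + 5" "Suc k = k + 1" by simp_all
    ultimately show ?thesis
      using neg[of \<alpha> "Y (k+2)" "Y (k+4)" "Y k"] neg[of 1 "Y (k+3)" "Y (k+5)" "Y (k+1)"]
      by (simp only: mult_1)
  qed
  have r2: "(exp (Y (k+7) - Y (k+5)) - 1) / (exp (Y (k+3) - Y (k+5)) - 1)
     \<le> (exp (Y (k+6) - Y (k+4)) - 1) / (exp (Y (k+2) - Y (k+4)) - 1)"
  proof -
    have "k + 4 \<ge> 1" "k + 2 \<ge> 1" "k + 6 \<ge> 1" "odd (k + 4)" "odd (k + 2)" "odd (k + 6)" "E (k+4) \<noteq> E (k+2)"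
      using x(5) o by auto
    note image_ratio[OF this]
    moreover have "Suc (k + 4) = k + 5" "Suc (k + 2) = k + 3" "Suc (k + 6) = k + 7" by simp_all
    moreover have "(exp (\<alpha> * (Y (k+6) - Y (k+4))) - 1) / (exp (\<alpha> * (Y (k+2) - Y (k+4))) - 1)
      \<le> (exp (Y (k+6) - Y (k+4)) - 1) / (exp (Y (k+2) - Y (k+4)) - 1)"
      using \<alpha> YY by (intro exp_ratio_mono) auto
    ultimately show ?thesis by (simp only:)
  qed
  note inv' = inv[unfolded block_inv_def]
  have pos: "0 < Y (k+4) - Y k" "0 < Y (k+6) - Y (k+4)" "0 < Y (k+2) - Y (k+6)"
    "0 < Y (k+5) - Y (k+1)" "0 < Y (k+7) - Y (k+5)" "0 < Y (k+3) - Y (k+7)" using YY by simp_all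
  have sums: "Y (k+6) - Y (k+4) + (Y (k+2) - Y (k+6)) = Y (k+2) - Y (k+4)"
    "V (k+6) - V (k+4) + (V (k+2) - V (k+6)) = V (k+2) - V (k+4)"
    "Y (k+7) - Y (k+5) + (Y (k+3) - Y (k+7)) = Y (k+3) - Y (k+5)"
    "V (k+7) - V (k+5) + (V (k+3) - V (k+7)) = V (k+3) - V (k+5)"
    "Y (k+4) - Y k + (Y (k+2) - Y (k+4)) = Y (k+2) - Y k"
    "V (k+4) - V k + (V (k+2) - V (k+4)) = V (k+2) - V k"
    "Y (k+5) - Y (k+1) + (Y (k+3) - Y (k+5)) = Y (k+3) - Y (k+1)"
    "V (k+5) - V (k+1) + (V (k+3) - V (k+5)) = V (k+3) - V (k+1)" by simp_all
  note bs = block_step[OF \<alpha> \<mu> pos, of "Y (k+2) - Y (k+4)" "V (k+2) - V (k+4)" "V (k+6) - V (k+4)" "V (k+2) - V (k+6)"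
    "Y (k+3) - Y (k+5)" "V (k+3) - V (k+5)" "V (k+7) - V (k+5)" "V (k+3) - V (k+7)"
    "p' k" "V (k+4) - V k" "p' (k+1)" "V (k+5) - V (k+1)" "p' (k+2)" "p' (k+3)" "p' (k+4)",
    unfolded sums, OF sm refl refl refl refl q0 q1(1) q1(2) q2(1) q2(2) q3(1) q3(2) r1 r2
      inv'[THEN conjunct1] inv'[THEN conjunct2, THEN conjunct1] inv'[THEN conjunct2, THEN conjunct2]]
  have con: "p' (k+1) \<ge> \<mu> \<and> p' (k+2) \<ge> \<mu> \<and> p' (k+3) \<ge> \<mu> \<and> p' (k+4) \<ge> \<mu> \<and>
     (V (k+6) - V (k+4)) / (1 - exp (- (Y (k+6) - Y (k+4)))) \<ge> \<mu> \<and>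
     (V (k+7) - V (k+5)) / (1 - exp (- (Y (k+7) - Y (k+5)))) \<ge> \<mu> + fP \<alpha> (Y (k+6) - Y (k+4)) * (V (k+6) - V (k+4))"
    by (intro conjI bs)
  then show "p' (k+1) \<ge> \<mu>" "p' (k+2) \<ge> \<mu>" "p' (k+3) \<ge> \<mu>" by auto
  have a2: "k + 4 + 2 = k + 6" "k + 4 + 3 = k + 7" "k + 4 + 1 = k + 5" by auto
  show "block_inv \<mu> (k+4)" unfolding block_inv_def a2 using con by auto
qed

lemma pc_deriv_ge:
  assumes \<mu>: "\<mu> > 0"
    and Z: "(V 1 - V 3) / (1 - exp (- (Y 1 - Y 3))) \<ge> \<mu>"
    and p0: "p' 0 \<ge> \<mu> + (\<alpha> - 1) * (V 1 - V 3)"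
  shows "p' n \<ge> \<mu>"
proof -
  note i = initial_steps[OF assms]
  have inv: "block_inv \<mu> (4 * j + 3)" for j
  proof (induction j)
    case 0 then show ?case using i by (simp add: block_inv_def)
  next
    case (Suc j)
    have "(4 * j + 3) mod 4 = 3" by presburger
    from block_inv_step(1)[OF \<mu> this Suc] show ?case by (simp add: algebra_simps)
  qed
  show ?thesis
  proof (cases "n < 3")
    case True
    then have "n = 0 \<or> n = 1 \<or> n = 2" by auto
    then show ?thesis using i by auto
  next
    case False
    define j where "j = (n - 3) div 4"
    have m: "(4 * j + 3) mod 4 = 3" by presburger
    note st = block_inv_step[OF \<mu> m inv]
    have "n = 4*j+3 \<or> n = 4*j+3+1 \<or> n = 4*j+3+2 \<or> n = 4*j+3+3" using False unfolding j_def by presburger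
    then show ?thesis using st inv[of j] unfolding block_inv_def by auto
  qed
qed

end

subsection \<open>The estimate at the first four points\<close>

text \<open>The Pade approximant has a cubic error at 0; it serves as a lower bound for ln \<alpha>
  with x = \<alpha>-1.\<close>

lemma ln_ge_Pade:
  fixes x :: real assumes "x \<ge> 0"
  shows "2 * x / (2 + x) \<le> ln (1 + x)"
proof -
  have "(\<lambda>x. ln (1 + x) - 2 * x / (2 + x)) 0 \<le> (\<lambda>x. ln (1 + x) - 2 * x / (2 + x)) x"
  proof (rule DERIV_nonneg_imp_nondecreasing[OF assms])
    fix u :: real assume "0 \<le> u" "u \<le> x"
    then have "DERIV (\<lambda>x. ln (1 + x) - 2 * x / (2 + x)) u :> 1 / (1 + u) - (2 * (2 + u) - 2 * u) / (2 + u)\<^sup>2"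
      by (auto intro!: derivative_eq_intros simp: power2_eq_square)
    moreover have "1 / (1 + u) - (2 * (2 + u) - 2 * u) / (2 + u)\<^sup>2 = u\<^sup>2 / ((1 + u) * (2 + u)\<^sup>2)"
      using \<open>0 \<le> u\<close> by (simp add: divide_simps) (simp add: algebra_simps power2_eq_square)
    moreover have "0 \<le> u\<^sup>2 / ((1 + u) * (2 + u)\<^sup>2)" using \<open>0 \<le> u\<close> by simp
    ultimately show "\<exists>y. DERIV (\<lambda>x. ln (1 + x) - 2 * x / (2 + x)) u :> y \<and> 0 \<le> y" by auto
  qed
  then show ?thesis by simp
qed

lemma neg_ln_le:
  fixes t :: real assumes "0 < t" "t \<le> 1"
  shows "- ln t \<le> (1 - t\<^sup>2) / (2 * t)"
proof -
  have "(\<lambda>x. (1 / x - x) / 2 + ln x) t \<ge> (\<lambda>x. (1 / x - x) / 2 + ln x) 1"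
  proof (rule DERIV_nonpos_imp_nonincreasing[OF assms(2)])
    fix u :: real assume "t \<le> u" "u \<le> 1"
    then have u: "u > 0" using assms by simp
    then have "DERIV (\<lambda>x. (1 / x - x) / 2 + ln x) u :> (- (1 / (u * u)) - 1) / 2 + 1 / u"
      by (auto intro!: derivative_eq_intros)
    moreover have "(- (1 / (u * u)) - 1) / 2 + 1 / u = - (((1 / u - 1)\<^sup>2) / 2)"
      using u by (simp add: field_simps power2_eq_square)
    moreover have "- (((1 / u - 1)\<^sup>2) / 2) \<le> 0" by simp
    ultimately show "\<exists>y. DERIV (\<lambda>x. (1 / x - x) / 2 + ln x) u :> y \<and> y \<le> 0" by auto
  qed
  moreover have "(1 / t - t) / 2 = (1 - t\<^sup>2) / (2 * t)" using assms by (simp add: field_simps power2_eq_square)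
  ultimately show ?thesis by simp
qed

lemma powr_Bernoulli:
  fixes y :: real assumes "\<alpha> > 1" "0 < y" "y < 1"
  shows "1 - y powr \<alpha> \<le> \<alpha> * (1 - y)"
proof -
  have "1 - exp (- (\<alpha> * (- ln y))) \<le> \<alpha> * (1 - exp (- (- ln y)))"
    using exp_Bernoulli_neg[of \<alpha> "- ln y"] assms by simp
  then show ?thesis using assms by (simp add: powr_def)
qed

text \<open>
  Here $y = 3_a$, and $\kappa$ is the ratio $r^0_e$. The second bound says that $\alpha$ cannot be small unless
  $t$ is: otherwise $4_a$ would be positive.
\<close>

lemma exponent_bound:
  fixes \<alpha> t y w \<kappa> :: real
  assumes "\<alpha> > 1" "0 < t" "t < 1" "0 < y" "y < 1"
    and y: "1 - y = (1 + t) * t powr \<alpha>"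
    and w: "w = 1 - y powr \<alpha>" "(1 + t) * w = \<kappa> * t" and \<kappa>: "0 < \<kappa>" "\<kappa> < 1"
  shows "w / (1 - w) \<le> \<kappa> * t"
    "(1 + t) * (1 + t * (1 - \<kappa>)) \<le> (t + \<alpha> * (1 + t)) * (1 - t)"
proof -
  have w01: "0 < w" "w < 1" using assms w(1) powr_less_mono2[of \<alpha> y 1] by auto
  have "\<kappa> * t * (1 - w) = (1 + t) * w * (1 - w)" using w(2) by simp
  moreover have "(1 + t) * (1 - w) \<ge> 1"
  proof -
    have "\<kappa> * t \<le> 1 * t" using \<kappa> assms by (intro mult_right_mono) auto
    then show ?thesis using w(2) by (simp add: algebra_simps)
  qed
  ultimately have "w \<le> \<kappa> * t * (1 - w)" using w01 mult_right_mono[of 1 "(1 + t) * (1 - w)" w] by (simp add: mult_ac)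
  then show wk: "w / (1 - w) \<le> \<kappa> * t" using w01 by (simp add: divide_le_eq)
  define e where "e = 1 - \<kappa>"
  define \<beta> where "\<beta> = \<alpha> - 1"
  have e: "0 < e" "e < 1" and \<beta>: "\<beta> > 0" using \<kappa> assms by (auto simp: e_def \<beta>_def)
  \<comment> \<open>The bound ln x <= x - 1 is used at y and at 1/(1-w), linked by y^\<alpha> = 1-w.
    The logarithm of the outcome is \<open>L\<close>.\<close>
  have "\<alpha> * (1 - y) \<le> \<alpha> * (- ln y)" using ln_le_minus_one[of y] assms by (intro mult_left_mono) auto
  also have "\<dots> = - ln (1 - w)" using assms w by (simp add: ln_powr)
  also have "\<dots> = ln (1 / (1 - w))" using w01 by (simp add: ln_div)
  also have "\<dots> \<le> 1 / (1 - w) - 1" using w01 by (intro ln_le_minus_one) auto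
  also have "\<dots> = w / (1 - w)" using w01 by (simp add: field_simps)
  also note wk
  finally have "\<alpha> * ((1 + t) * t powr \<alpha>) \<le> \<kappa> * t" using y by simp
  then have "ln (\<alpha> * ((1 + t) * t powr \<alpha>)) \<le> ln (\<kappa> * t)" using assms \<kappa> by (subst ln_le_cancel_iff) auto
  then have "ln \<alpha> + ln (1 + t) + \<alpha> * ln t \<le> ln \<kappa> + ln t"
    using assms \<kappa> by (simp add: ln_mult ln_powr)
  then have L: "ln \<alpha> + ln (1 + t) - ln \<kappa> \<le> \<beta> * (- ln t)" by (simp add: \<beta>_def algebra_simps)
  have l\<kappa>: "- ln \<kappa> \<ge> e" using ln_le_minus_one[of \<kappa>] \<kappa> by (simp add: e_def)
  have lt: "ln (1 + t) \<ge> t - t\<^sup>2" using ln_one_plus_pos_lower_bound[of t] assms by simp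
  have t2: "1 - t\<^sup>2 > 0" using assms by (simp add: power_less_one_iff abs_square_less_1)
  \<comment> \<open>In terms of p the claim reads p >= 2t^2 + te(1+t).\<close>
  define p where "p = \<beta> * (1 - t\<^sup>2)"
  have p: "p > 0" using \<beta> t2 by (simp add: p_def)
  have "\<beta> * (- ln t) \<le> \<beta> * ((1 - t\<^sup>2) / (2 * t))" using neg_ln_le[of t] assms \<beta> by (intro mult_left_mono) auto
  then have L2: "ln \<alpha> + (t - t\<^sup>2) + e \<le> p / (2 * t)" using L l\<kappa> lt by (simp add: p_def)
  show "(1 + t) * (1 + t * (1 - \<kappa>)) \<le> (t + \<alpha> * (1 + t)) * (1 - t)"
  proof (rule ccontr)
    assume "\<not> ?thesis"
    then have p2: "p < 2 * t\<^sup>2 + t * e * (1 + t)"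
      by (simp add: p_def \<beta>_def e_def algebra_simps power2_eq_square)
    show False
    \<comment> \<open>The smaller of p and 2t^2 is at most 2\<beta>/(2+\<beta>), hence at most ln
      \<alpha>; either bound contradicts \<open>L2\<close>.\<close>
    proof (cases "p \<le> 2 * t\<^sup>2")
      case True
      have "p * (2 + \<beta>) \<le> 2 * \<beta>"
      proof -
        have "2 * \<beta> - p * (2 + \<beta>) = \<beta> * (2 * t\<^sup>2 - p)" by (simp add: p_def algebra_simps)
        moreover have "\<dots> \<ge> 0" using True \<beta> by simp
        ultimately show ?thesis by linarith
      qed
      then have "p \<le> 2 * \<beta> / (2 + \<beta>)" using \<beta> by (simp add: le_divide_eq)
      also have "\<dots> \<le> ln (1 + \<beta>)" using ln_ge_Pade[of \<beta>] \<beta> by simp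
      finally have "p \<le> ln \<alpha>" by (simp add: \<beta>_def)
      then have c: "p + t - t\<^sup>2 + e \<le> p / (2 * t)" using L2 by simp
      show False
      proof (cases "2 * t \<ge> 1")
        case True
        then have "p / (2 * t) \<le> p" using p by (simp add: divide_le_eq mult_le_cancel_left1)
        moreover have "t - t\<^sup>2 > 0" using assms by (simp add: power2_eq_square)
        ultimately show False using c e by linarith
      next
        case False
        then have "p * (1 / (2 * t) - 1) \<le> 2 * t\<^sup>2 * (1 / (2 * t) - 1)"
          using \<open>p \<le> 2 * t\<^sup>2\<close> assms by (intro mult_right_mono) (auto simp: le_divide_eq)
        also have "\<dots> = t - 2 * t\<^sup>2" using assms by (simp add: field_simps power2_eq_square)
        finally have "p / (2 * t) - p \<le> t - 2 * t\<^sup>2" by (simp add: right_diff_distrib)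
        moreover have "t\<^sup>2 > 0" using assms by simp
        ultimately show False using c e by linarith
      qed
    next
      case False
      have "t\<^sup>2 * (2 + \<beta>) \<le> \<beta>" using False by (simp add: p_def algebra_simps)
      then have "2 * t\<^sup>2 \<le> 2 * \<beta> / (2 + \<beta>)" using \<beta> by (simp add: le_divide_eq algebra_simps)
      also have "\<dots> \<le> ln (1 + \<beta>)" using ln_ge_Pade[of \<beta>] \<beta> by simp
      finally have "2 * t\<^sup>2 \<le> ln \<alpha>" by (simp add: \<beta>_def)
      moreover have "p / (2 * t) \<le> t + e"
      proof -
        have "t * e * (1 + t) \<le> t * e * 2" using assms e by (intro mult_left_mono) auto
        then have "p \<le> (t + e) * (2 * t)" using p2 by (simp add: algebra_simps power2_eq_square)
        then show ?thesis using assms by (simp add: divide_le_eq)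
      qed
      moreover have "t\<^sup>2 > 0" using assms by simp
      ultimately show False using L2 by linarith
    qed
  qed
qed

text \<open>Q/(t(1+t)) is the logarithmic derivative of (1+t)t^\<alpha> = 1-y, and -H/t is the part
  of the derivative of |4_a| that comes through y. The two bounded quantities are the rate of the
  gap between points 1 and 3, and the coordinate velocity at index 0 minus the charge for index
  1.\<close>

lemma base_estimate:
  fixes \<alpha> t y w \<kappa> Q H :: real
  assumes "\<alpha> > 1" "0 < t" "t < 1" "0 < y" "y < 1"
    and y: "1 - y = (1 + t) * t powr \<alpha>"
    and w: "w = 1 - y powr \<alpha>" "(1 + t) * w = \<kappa> * t" and \<kappa>: "\<kappa> < 1"
    and Q: "Q = t + \<alpha> * (1 + t)"
    and H: "H = \<alpha> * y powr (\<alpha> - 1) * (1 - y) * Q"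
  shows "2 / (1 - t\<^sup>2) < Q / (t * (1 + t) * y)"
    "2 / (1 - t\<^sup>2) < (H / w - 1) / ((1 + t) * (t - (1 + t) * w)) - (\<alpha> - 1) * ((1 - y) * Q / (t * (1 + t) * y))"
proof -
  have w01: "0 < w" "w < 1" using assms w(1) powr_less_mono2[of \<alpha> y 1] by auto
  have "\<kappa> * t > 0" using w(2) w01 assms by (metis add_pos_pos mult_pos_pos zero_less_one)
  then have \<kappa>0: "\<kappa> > 0" using assms by (simp add: zero_less_mult_iff)
  note eb = exponent_bound[OF assms(1-5) y w \<kappa>0 \<kappa>, folded Q]
  define e where "e = 1 - \<kappa>"
  \<comment> \<open>Chosen so that 2/(1-t^2) = (Q0-1)/(t(1+t)); then \<open>exponent_bound\<close>
    says Q0(1+te) <= Q.\<close>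
  define Q0 where "Q0 = (1 + t) / (1 - t)"
  define G where "G = H / (w * Q)"
  have e: "0 < e" "e < 1" using \<kappa>0 \<kappa> by (auto simp: e_def)
  have Qpos: "Q > 0" using assms by (simp add: Q add_pos_pos)
  have Q0: "Q0 * (1 + t * e) \<le> Q" using eb(2) assms by (simp add: Q0_def e_def divide_le_eq)
  have Q0pos: "Q0 > 1" using assms by (simp add: Q0_def)
  have "Q0 * 1 \<le> Q0 * (1 + t * e)" using Q0pos e assms(2) by (intro mult_left_mono) auto
  then have Q01: "Q0 \<le> Q" using Q0 by linarith
  have D: "2 / (1 - t\<^sup>2) = (Q0 - 1) / (t * (1 + t))"
  proof -
    have "Q0 - 1 = 2 * t / (1 - t)" using assms by (simp add: Q0_def field_simps)
    moreover have "1 - t\<^sup>2 = (1 - t) * (1 + t)" by (simp add: algebra_simps power2_eq_square)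
    ultimately show ?thesis using assms by simp
  qed
  have tb: "t * (1 + t) > 0" using assms by simp
  have "(Q0 - 1) * y < Q" 
  proof -
    have "(Q0 - 1) * y \<le> (Q0 - 1) * 1" using Q0pos assms by (intro mult_left_mono) auto
    then have "(Q0 - 1) * y \<le> Q0 - 1" by simp
    also have "\<dots> < Q" using Q01 by simp
    finally show ?thesis .
  qed
  then show "2 / (1 - t\<^sup>2) < Q / (t * (1 + t) * y)" unfolding D using tb assms by (simp add: divide_simps mult_ac)
  have G1: "G \<ge> 1 - w"
  proof -
    have "y powr \<alpha> \<le> y powr (\<alpha> - 1)" using assms by (intro powr_mono') auto
    moreover have "w \<le> \<alpha> * (1 - y)" using powr_Bernoulli[of \<alpha> y] assms w by simp
    ultimately have "y powr \<alpha> * w \<le> y powr (\<alpha> - 1) * (\<alpha> * (1 - y))" using w01 by (intro mult_mono) auto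
    then have "(1 - w) * w \<le> G * w" using w01 Qpos by (simp add: G_def H w(1) mult_ac)
    then show ?thesis using w01 by simp
  qed
  have GQ: "H / w = G * Q" using Qpos by (simp add: G_def)
  have G0: "G \<ge> 0" using G1 w01 by simp
  have loss: "(\<alpha> - 1) * ((1 - y) * Q / y) \<le> G * Q * (\<kappa> * t)"
  proof -
    have "(1 - y) / y = H / (\<alpha> * (1 - w) * Q)"
    proof -
      define A where "A = y powr \<alpha>"
      have A: "A > 0" "1 - w = A" "y powr (\<alpha> - 1) = A / y" using assms(4) by (auto simp: A_def w(1) powr_diff)
      have "H = (1 - y) / y * (\<alpha> * A * Q)" unfolding H A by simp
      moreover have "\<alpha> * A * Q \<noteq> 0" using A Qpos assms(1) by simp
      ultimately show ?thesis unfolding A by simp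
    qed
    then have "(1 - y) * Q / y = H / (\<alpha> * (1 - w) * Q) * Q" by (metis times_divide_eq_left)
    also have "\<dots> = H / (\<alpha> * (1 - w))" using Qpos by simp
    also have "\<dots> = H / w * (w / (1 - w)) / \<alpha>" using w01 by simp
    finally have "(1 - y) * Q / y = G * Q * (w / (1 - w)) / \<alpha>" unfolding GQ .
    then have "(\<alpha> - 1) * ((1 - y) * Q / y) = (\<alpha> - 1) / \<alpha> * (G * Q * (w / (1 - w)))" by simp
    also have "\<dots> \<le> 1 * (G * Q * (w / (1 - w)))"
      using assms w01 G0 Qpos by (intro mult_right_mono) auto
    also have "\<dots> \<le> G * Q * (\<kappa> * t)" using mult_left_mono[OF eb(1), of "G * Q"] G0 Qpos by simp
    finally show ?thesis .
  qed
  \<comment> \<open>The factor 1+te outweighs the charge, since (1+te)(1-\<kappa>et) >= 1; after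
    that (1-w)Q0 - 1 exceeds e(Q0-1) by exactly \<kappa>t/(1-t).\<close>
  have key: "e * (Q0 - 1) < G * Q * (1 - \<kappa> * e * t) - 1"
  proof -
    have ket: "\<kappa> * e * t \<le> 1"
      using mult_mono[of "\<kappa>" 1 e 1] mult_mono[of "\<kappa> * e" 1 t 1] \<kappa>0 \<kappa> e assms by simp
    have "(1 + t * e) * (1 - \<kappa> * e * t) - 1 = t * e * e * (1 - \<kappa> * t)"
      by (simp add: e_def algebra_simps)
    moreover have "\<kappa> * t \<le> 1" using mult_mono[of \<kappa> 1 t 1] \<kappa> \<kappa>0 assms by simp
    ultimately have one: "1 \<le> (1 + t * e) * (1 - \<kappa> * e * t)"
      using assms e by (smt (verit) mult_nonneg_nonneg)
    have "(1 - w) * Q0 * 1 \<le> (1 - w) * Q0 * ((1 + t * e) * (1 - \<kappa> * e * t))"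
      using one w01 Q0pos by (intro mult_left_mono) auto
    also have "\<dots> = (1 - w) * (Q0 * (1 + t * e)) * (1 - \<kappa> * e * t)" by simp
    also have "\<dots> \<le> G * Q * (1 - \<kappa> * e * t)"
      using G1 Q0 ket w01 Q0pos e assms G0 by (intro mult_right_mono mult_mono) auto
    finally have "(1 - w) * Q0 \<le> G * Q * (1 - \<kappa> * e * t)" by simp
    moreover have "(1 - w) * Q0 - 1 - e * (Q0 - 1) = \<kappa> * t / (1 - t)"
    proof -
      have "w = \<kappa> * t / (1 + t)" using w(2) assms by (simp add: field_simps)
      then have "w * Q0 = \<kappa> * t / (1 - t)" using assms by (simp add: Q0_def)
      moreover have "\<kappa> * (Q0 - 1) = 2 * (\<kappa> * t / (1 - t))"
        using assms by (simp add: Q0_def field_simps)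
      ultimately show ?thesis by (simp add: e_def algebra_simps)
    qed
    moreover have "\<kappa> * t / (1 - t) > 0" using \<kappa>0 assms by simp
    ultimately show ?thesis by linarith
  qed
  have "Q0 - 1 < (G * Q - 1) / e - G * Q * (\<kappa> * t)"
  proof -
    have "Q0 - 1 < (G * Q * (1 - \<kappa> * e * t) - 1) / e" using key e by (simp add: less_divide_eq mult_ac)
    also have "\<dots> = (G * Q - 1) / e - G * Q * (\<kappa> * t)" using e by (simp add: field_simps)
    finally show ?thesis .
  qed
  then have "Q0 - 1 < (G * Q - 1) / e - (\<alpha> - 1) * ((1 - y) * Q / y)" using loss by linarith
  then have "(Q0 - 1) / (t * (1 + t)) < ((G * Q - 1) / e - (\<alpha> - 1) * ((1 - y) * Q / y)) / (t * (1 + t))"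
    using tb by (intro divide_strict_right_mono) auto
  also have "\<dots> = (H / w - 1) / ((1 + t) * (t - (1 + t) * w)) - (\<alpha> - 1) * ((1 - y) * Q / (t * (1 + t) * y))"
  proof -
    have eT: "(1 + t) * (t - (1 + t) * w) = e * (t * (1 + t))" unfolding w(2) by (simp add: e_def algebra_simps)
    have "((G * Q - 1) / e - L) / T = (G * Q - 1) / (e * T) - L / T" for L T :: real
      by (simp add: diff_divide_distrib)
    moreover have "(\<alpha> - 1) * ((1 - y) * Q / y) / T = (\<alpha> - 1) * ((1 - y) * Q / (T * y))" for T :: real
      by (simp add: mult.commute)
    ultimately show ?thesis unfolding GQ eT by (simp only:)
  qed
  finally show "2 / (1 - t\<^sup>2) < (H / w - 1) / ((1 + t) * (t - (1 + t) * w)) - (\<alpha> - 1) * ((1 - y) * Q / (t * (1 + t) * y))"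
    unfolding D .
qed

context kneading
begin

lemma E'_1: "E' (Suc 0) = 0" by (simp add: aorb_deriv.simps(2))
lemma E'_2: "E' 2 = 1" using aorb_deriv.simps(2)[of \<alpha> t "Suc 0"] by (simp add: E_1 E'_1 flip: numeral_2_eq_2)

lemma pc_deriv_gt: "2 / (1 - t\<^sup>2) < p' n"
proof -
  define y where "y = E 3"
  define w where "w = 1 - y powr \<alpha>"
  define Q where "Q = t + \<alpha> * b"
  define H where "H = \<alpha> * y powr (\<alpha> - 1) * (1 - y) * Q"
  define \<kappa> where "\<kappa> = b * w / t"
  have y: "0 < y" "y < 1" "1 - y = b * t powr \<alpha>" using E3 E_3_eq t0 by (auto simp: y_def)
  have w01: "0 < w" using y \<alpha> powr_less_mono2[of \<alpha> y 1] by (simp add: w_def)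
  have E4w: "E 4 = t - b * w" using E_4_eq by (simp add: y_def w_def algebra_simps)
  have bw: "b * w < t" using E4 E4w by simp
  have \<kappa>: "b * w = \<kappa> * t" "\<kappa> < 1" using t0 bw by (auto simp: \<kappa>_def)
  note be = base_estimate[OF \<alpha> t0 t1 y w_def \<kappa> Q_def H_def]
  have E'3: "E' 3 = - ((1 - y) * Q / (t * b))"
  proof -
    have "E' 3 = - (t powr \<alpha> + b * (\<alpha> * t powr (\<alpha> - 1)))"
      using aorb_deriv.simps(2)[of \<alpha> t 2] by (simp add: E_2 E'_2)
    also have "t powr (\<alpha> - 1) = t powr \<alpha> / t" using t0 by (simp add: powr_diff)
    also have "t powr \<alpha> + b * (\<alpha> * (t powr \<alpha> / t)) = t powr \<alpha> * Q / t"
      using t0 by (simp add: Q_def field_simps)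
    also have "\<dots> = (b * t powr \<alpha>) * Q / (t * b)" using t0 by simp
    finally show ?thesis by (simp add: y(3))
  qed
  have V13: "V 1 - V 3 = (1 - y) * Q / (t * b * y)" using E'3 y by (simp add: V_def E'_1 y_def)
  have "exp (- (Y 1 - Y 3)) = y" using Y_1 y by (simp add: Y_def y_def)
  then have Z: "(V 1 - V 3) / (1 - exp (- (Y 1 - Y 3))) = Q / (t * b * y)" using V13 y by simp
  have E'4: "E' 4 = 1 - w - H / t"
  proof -
    have "E' 4 = y powr \<alpha> + b * (\<alpha> * y powr (\<alpha> - 1) * E' 3)"
      using aorb_deriv.simps(2)[of \<alpha> t 3] by (simp add: y_def)
    then show ?thesis unfolding E'3 using t0 by (simp add: H_def w_def)
  qed
  have p0: "p' 0 = (H / w - 1) / (b * (t - b * w))"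
  proof -
    have "p' 0 = (E' 4 - 1) / (E 4 - t) - E' 4 / E 4"
      by (simp add: pc_deriv_def E_2 E'_2 flip: numeral_2_eq_2)
    also have "E 4 - t = - (b * w)" using E4w by simp
    also have "(E' 4 - 1) / (- (b * w)) = (w + H / t) / (b * w)"
      by (subst minus_divide_divide[symmetric]) (simp add: E'4)
    also have "(w + H / t) / (b * w) - E' 4 / E 4
        = ((w + H / t) * (t - b * w) - (1 - w - H / t) * (b * w)) / (b * w * (t - b * w))"
      unfolding E'4 E4w by (rule diff_frac_eq) (use w01 bw t0 in auto)
    also have "(w + H / t) * (t - b * w) - (1 - w - H / t) * (b * w) = H - w"
    proof -
      define h where "h = H / t"
      then have "H = h * t" using t0 by simp
      moreover have "(w + h) * (t - b * w) - (1 - w - h) * (b * w) = h * t - w" by (simp add: algebra_simps)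
      ultimately show ?thesis unfolding h_def by simp
    qed
    also have "(H - w) / (b * w * (t - b * w)) = ((H - w) / w) / (b * (t - b * w))" by simp
    also have "(H - w) / w = H / w - 1" using w01 by (simp add: diff_divide_distrib)
    finally show ?thesis .
  qed
  \<comment> \<open>The largest constant allowed by both hypotheses of \<open>pc_deriv_ge\<close>.
    It exceeds 2/(1-t^2) strictly, so the weak bound from the induction becomes a strict
    one.\<close>
  define \<mu> where "\<mu> = min (Q / (t * b * y)) (p' 0 - (\<alpha> - 1) * (V 1 - V 3))"
  have D: "2 / (1 - t\<^sup>2) < \<mu>" unfolding \<mu>_def V13 p0 min_less_iff_conj using be by blast
  have "t\<^sup>2 < 1" using t0 t1 by (simp add: abs_square_less_1)
  then have "0 < 2 / (1 - t\<^sup>2)" by simp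
  then have "\<mu> > 0" using D by linarith
  moreover have "(V 1 - V 3) / (1 - exp (- (Y 1 - Y 3))) \<ge> \<mu>" unfolding Z \<mu>_def by (rule min.cobounded1)
  moreover have "\<mu> \<le> p' 0 - (\<alpha> - 1) * (V 1 - V 3)" unfolding \<mu>_def by (rule min.cobounded2)
  then have "p' 0 \<ge> \<mu> + (\<alpha> - 1) * (V 1 - V 3)" by linarith
  ultimately have "p' n \<ge> \<mu>" by (rule pc_deriv_ge)
  then show ?thesis using D by simp
qed

end

subsection \<open>Integration over the parameter\<close>

context kneading
begin

lemma aorb_has_derivative:
  "((\<lambda>\<tau>. aorb \<alpha> \<tau> n) has_real_derivative E' n) (at t)"
proof (induction n)
  case 0
  show ?case by simp
next
  case (Suc n)
  show ?case
  proof (cases "n = 0")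
    case True
    then show ?thesis by (simp add: aorb.simps(2) aorb_deriv.simps(2))
  next
    case False
    then have pos: "E n > 0" using E_pos by simp
    have "((\<lambda>\<tau>. (1 + \<tau>) * aorb \<alpha> \<tau> n powr \<alpha>) has_real_derivative
        E n powr \<alpha> + b * (\<alpha> * E n powr (\<alpha> - 1) * E' n)) (at t)"
      using pos by (auto intro!: derivative_eq_intros Suc DERIV_fun_powr simp: algebra_simps)
    from DERIV_diff[OF DERIV_const[of 1] this] DERIV_diff[OF this DERIV_const[of 1]]
    show ?thesis unfolding aorb.simps aorb_deriv.simps by (cases "even n") simp_all
  qed
qed

lemma E_ratio_pos: "(E (n+4) - E (n+2)) / (E n - E (n+4)) > 0"
  using E_order[of n] by (auto simp: zero_less_divide_iff split: if_splits)

lemma log_ratio_has_derivative: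
  "((\<lambda>\<tau>. ln ((aorb \<alpha> \<tau> (n+4) - aorb \<alpha> \<tau> (n+2)) / (aorb \<alpha> \<tau> n - aorb \<alpha> \<tau> (n+4))))
    has_real_derivative p' n) (at t)"
proof -
  define A where "A = E (n+4) - E (n+2)"
  define B where "B = E n - E (n+4)"
  define A' where "A' = E' (n+4) - E' (n+2)"
  define B' where "B' = E' n - E' (n+4)"
  have q: "A / B > 0" using E_ratio_pos[of n] by (simp add: A_def B_def)
  then have nz: "A \<noteq> 0" "B \<noteq> 0" by auto
  have 1: "((\<lambda>\<tau>. aorb \<alpha> \<tau> (n+4) - aorb \<alpha> \<tau> (n+2)) has_real_derivative A') (at t)"
    "((\<lambda>\<tau>. aorb \<alpha> \<tau> n - aorb \<alpha> \<tau> (n+4)) has_real_derivative B') (at t)"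
    unfolding A'_def B'_def by (intro DERIV_diff aorb_has_derivative)+
  have "((\<lambda>\<tau>. (aorb \<alpha> \<tau> (n+4) - aorb \<alpha> \<tau> (n+2)) / (aorb \<alpha> \<tau> n - aorb \<alpha> \<tau> (n+4)))
      has_real_derivative (A' * B - A * B') / (B * B)) (at t)"
    using DERIV_divide[OF 1] nz by (simp add: A_def B_def)
  from DERIV_chain2[OF DERIV_ln this] q
  have "((\<lambda>\<tau>. ln ((aorb \<alpha> \<tau> (n+4) - aorb \<alpha> \<tau> (n+2)) / (aorb \<alpha> \<tau> n - aorb \<alpha> \<tau> (n+4))))
      has_real_derivative inverse (A / B) * ((A' * B - A * B') / (B * B))) (at t)"
    by (simp add: A_def B_def)
  moreover have "inverse (A / B) * ((A' * B - A * B') / (B * B)) = A' / A - B' / B"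
    using nz by (simp add: field_simps)
  ultimately show ?thesis unfolding pc_deriv_def A_def B_def A'_def B'_def by simp
qed

text \<open>
  The condition $4_a < 0$ reads $\ln(1+t) + \alpha \ln 3_a > 0$, and the left-hand side is concave in $t$ and
  vanishes at $0$.
\<close>

lemma smaller_parameter:
  assumes "0 < u" "u \<le> t"
  shows "kneading \<alpha> u"
proof
  show "\<alpha> > 1" "u > 0" using \<alpha> assms by auto
  define c where "c = u / t"
  have c: "0 < c" "c \<le> 1" "u = c * t" using assms t0 by (auto simp: c_def)
  define x where "x = 1 - (1 + u) * u powr \<alpha>"
  have y: "0 < E 3" "E 3 = 1 - b * t powr \<alpha>" using E3 E_3_eq by auto
  have "u powr \<alpha> \<le> c * t powr \<alpha>"
  proof -
    have "u powr (\<alpha> - 1) \<le> t powr (\<alpha> - 1)" using assms \<alpha> by (intro powr_mono2) auto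
    then have "u * u powr (\<alpha> - 1) \<le> u * t powr (\<alpha> - 1)" using assms by (intro mult_left_mono) auto
    then show ?thesis using assms t0 by (simp add: powr_diff c_def)
  qed
  then have "(1 + u) * u powr \<alpha> \<le> b * (c * t powr \<alpha>)" using assms t0 by (intro mult_mono) auto
  then have x: "x \<ge> (1 - c) * 1 + c * E 3" by (simp add: x_def y(2) algebra_simps)
  \<comment> \<open>Applied at z = E 3 and at z = 1+t, using 1+u = (1-c) + c(1+t).\<close>
  have conc: "c * ln z \<le> ln ((1 - c) * 1 + c * z)" if "z > 0" for z :: real
    using concave_onD[OF ln_concave, of c 1 z] that c by simp
  have pos: "(1 - c) * 1 + c * E 3 > 0" using c y by (intro add_nonneg_pos) auto
  then have x0: "x > 0" using x by linarith
  have "c * ln (E 3) \<le> ln x" using conc[of "E 3"] y x pos x0 by (smt (verit) ln_le_cancel_iff)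
  moreover have "c * ln b \<le> ln (1 + u)" using conc[of b] t0 by (simp add: c(3) algebra_simps)
  moreover have "0 < ln b + \<alpha> * ln (E 3)"
  proof -
    have "1 < b * E 3 powr \<alpha>" using E4 E_4_eq by simp
    then have "0 < ln (b * E 3 powr \<alpha>)" by (rule ln_gt_zero)
    then show ?thesis using t0 y by (simp add: ln_mult ln_powr)
  qed
  then have "0 < c * (ln b + \<alpha> * ln (E 3))" using c by simp
  moreover have "\<alpha> * (c * ln (E 3)) \<le> \<alpha> * ln x" using \<alpha> calculation(1) by simp
  ultimately have "0 < ln (1 + u) + \<alpha> * ln x" by (simp add: distrib_left mult_ac)
  then have "0 < ln ((1 + u) * x powr \<alpha>)" using x0 assms by (simp add: ln_mult ln_powr)
  then have big: "1 < (1 + u) * x powr \<alpha>" using x0 assms by (simp add: ln_gt_zero_iff)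
  have u1: "aorb \<alpha> u (Suc 0) = 1" by (simp add: aorb.simps(2))
  have u2: "aorb \<alpha> u 2 = u" using aorb.simps(2)[of \<alpha> u "Suc 0"] by (simp add: u1 flip: numeral_2_eq_2)
  have u3: "aorb \<alpha> u 3 = x" using aorb.simps(2)[of \<alpha> u 2] by (simp add: u2 x_def)
  have u4: "aorb \<alpha> u 4 = (1 + u) * x powr \<alpha> - 1" using aorb.simps(2)[of \<alpha> u 3] by (simp add: u3)
  show "aorb \<alpha> u 3 > 0" "aorb \<alpha> u 4 > 0" using u3 u4 x0 big by auto
qed

end

text \<open>2/(1-u^2) is the derivative of ln((1+u)/(1-u)), so the difference of the two logarithms
  increases; \<open>smaller_parameter\<close> makes the derivative bound available at every
  intermediate u.\<close>

lemma log_ratio_increase: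
  assumes "kneading \<alpha> t'" "0 < t" "t < t'"
  shows "ln ((aorb \<alpha> t' (n+4) - aorb \<alpha> t' (n+2)) / (aorb \<alpha> t' n - aorb \<alpha> t' (n+4)))
       - ln ((aorb \<alpha> t (n+4) - aorb \<alpha> t (n+2)) / (aorb \<alpha> t n - aorb \<alpha> t (n+4)))
    > ln ((1 + t') / (1 - t')) - ln ((1 + t) / (1 - t))"
proof -
  define f where "f \<tau> = ln ((aorb \<alpha> \<tau> (n+4) - aorb \<alpha> \<tau> (n+2)) / (aorb \<alpha> \<tau> n - aorb \<alpha> \<tau> (n+4)))
    - ln ((1 + \<tau>) / (1 - \<tau>))" for \<tau>
  have "f t < f t'"
  proof (rule DERIV_pos_imp_increasing[OF assms(3)])
    fix u assume u: "t \<le> u" "u \<le> t'"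
    then interpret k: kneading \<alpha> u using kneading.smaller_parameter[OF assms(1)] assms(2) by simp
    have u1: "0 < u" "u < 1" using k.t0 k.t1 by auto
    have "((\<lambda>\<tau>. ln ((1 + \<tau>) / (1 - \<tau>))) has_real_derivative 2 / (1 - u\<^sup>2)) (at u)"
    proof -
      have "((\<lambda>\<tau>. (1 + \<tau>) / (1 - \<tau>)) has_real_derivative 2 / ((1 - u) * (1 - u))) (at u)"
        using u1 by (auto intro!: derivative_eq_intros)
      from DERIV_chain2[OF DERIV_ln this] u1
      have "((\<lambda>\<tau>. ln ((1 + \<tau>) / (1 - \<tau>))) has_real_derivative
          inverse ((1 + u) / (1 - u)) * (2 / ((1 - u) * (1 - u)))) (at u)" by simp
      moreover have inv: "inverse (p / q) * (2 / (q * q)) = 2 / (p * q)" if "q \<noteq> 0" for p q :: real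
        using that by (simp add: field_simps)
      moreover have "inverse ((1 + u) / (1 - u)) * (2 / ((1 - u) * (1 - u))) = 2 / ((1 + u) * (1 - u))"
        by (rule inv) (use u1 in simp)
      moreover have "(1 + u) * (1 - u) = 1 - u\<^sup>2" by (simp add: algebra_simps power2_eq_square)
      ultimately show ?thesis by (simp only:)
    qed
    then have "(f has_real_derivative (pc_deriv \<alpha> u n - 2 / (1 - u\<^sup>2))) (at u)"
      unfolding f_def [abs_def] by (intro DERIV_diff k.log_ratio_has_derivative)
    then show "\<exists>y. DERIV f u :> y \<and> 0 < y" using k.pc_deriv_gt[of n] by (metis diff_gt_0_iff_gt)
  qed
  then show ?thesis unfolding f_def by linarith
qed

section \<open>Return to the signed orbit\<close>

lemma orb_Suc: "orb \<alpha> a (Suc n) = 1 - a powr (\<alpha> - 1) * \<bar>orb \<alpha> a n\<bar> powr \<alpha>"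
  by (simp add: orb_def)

lemma kneadRL_kneading:
  assumes \<alpha>: "\<alpha> > 1" and a: "a > 1" and k: "kneadRL \<alpha> a"
  defines "t \<equiv> a powr (\<alpha> - 1) - 1"
  shows "kneading \<alpha> t" "orb \<alpha> a n = (if odd n then aorb \<alpha> t n else - aorb \<alpha> t n)"
proof -
  have t: "a powr (\<alpha> - 1) = 1 + t" "t > 0"
    using a \<alpha> powr_less_mono2[of "\<alpha> - 1" 1 a] by (auto simp: t_def)
  have "orb \<alpha> a (2 * 1 + 1) > 0 \<and> orb \<alpha> a (2 * 1 + 2) < 0" using k unfolding kneadRL_def by blast
  moreover have "2 * 1 + 1 = (3::nat)" "2 * 1 + 2 = (4::nat)" by simp_all
  ultimately have pos: "orb \<alpha> a 3 > 0" "orb \<alpha> a 4 < 0" by (simp_all only:)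
  have u1: "aorb \<alpha> t (Suc 0) = 1" by (simp add: aorb.simps(2))
  have u2: "aorb \<alpha> t 2 = t" using aorb.simps(2)[of \<alpha> t "Suc 0"] by (simp add: u1 flip: numeral_2_eq_2)
  have u3: "aorb \<alpha> t 3 = 1 - (1 + t) * t powr \<alpha>" using aorb.simps(2)[of \<alpha> t 2] by (simp add: u2)
  have u4: "aorb \<alpha> t 4 = (1 + t) * aorb \<alpha> t 3 powr \<alpha> - 1" using aorb.simps(2)[of \<alpha> t 3] by simp
  have o1: "orb \<alpha> a (Suc 0) = 1" by (simp add: orb_def)
  have o2: "orb \<alpha> a 2 = - t" using orb_Suc[of \<alpha> a "Suc 0"] t o1 by (simp flip: numeral_2_eq_2)
  have o3: "orb \<alpha> a 3 = aorb \<alpha> t 3" using orb_Suc[of \<alpha> a 2] o2 t u3 by simp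
  have o4: "orb \<alpha> a 4 = - aorb \<alpha> t 4" using orb_Suc[of \<alpha> a 3] o3 t u4 pos by simp
  show kn: "kneading \<alpha> t" using \<alpha> t pos o3 o4 by unfold_locales auto
  interpret kneading \<alpha> t by (rule kn)
  show "orb \<alpha> a n = (if odd n then aorb \<alpha> t n else - aorb \<alpha> t n)"
  proof (induction n)
    case 0
    show ?case by (simp add: orb_def)
  next
    case (Suc n)
    then have "\<bar>orb \<alpha> a n\<bar> = aorb \<alpha> t n" using E_nonneg[of n] by auto
    then show ?case unfolding orb_Suc t(1) by (simp add: aorb.simps(2))
  qed
qed

text \<open>With q = A/B the quotient is q/(1+q), increasing in q. For A and B the two parts of the
  interval between points n and n+2, this turns growth of the Poincare coordinate into growth of the
  ratio functions.\<close>

lemma ratio_less_of_ln_less: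
  fixes A B A' B' :: real
  assumes "A / B > 0" "A' / B' > 0" "ln (A / B) < ln (A' / B')"
  shows "\<bar>A\<bar> / \<bar>A + B\<bar> < \<bar>A'\<bar> / \<bar>A' + B'\<bar>"
proof -
  have form: "\<bar>A\<bar> / \<bar>A + B\<bar> = 1 - 1 / (1 + A / B)" if "A / B > 0" for A B :: real
  proof -
    have "A \<noteq> 0" "B \<noteq> 0" "\<bar>1 + A / B\<bar> = 1 + A / B" using that by auto
    moreover have "\<bar>A / B\<bar> = A / B" using that by (rule abs_of_pos)
    ultimately have "\<bar>A\<bar> = A / B * \<bar>B\<bar>" using abs_mult[of "A / B" B] by simp
    moreover have "A + B = (1 + A / B) * B" using \<open>B \<noteq> 0\<close> by (simp add: field_simps)
    then have "\<bar>A + B\<bar> = (1 + A / B) * \<bar>B\<bar>" using \<open>\<bar>1 + A / B\<bar> = 1 + A / B\<close> by (metis abs_mult)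
    ultimately have "\<bar>A\<bar> / \<bar>A + B\<bar> = (A / B) / (1 + A / B)" using \<open>B \<noteq> 0\<close> by simp
    also have "\<dots> = 1 - 1 / (1 + A / B)"
    proof -
      define q where "q = A / B"
      have "q / (1 + q) = 1 - 1 / (1 + q)" if "q > 0" using that by (simp add: field_simps)
      then show ?thesis using that unfolding q_def by simp
    qed
    finally show ?thesis .
  qed
  have "A / B < A' / B'" using assms by simp
  then have "1 / (1 + A' / B') < 1 / (1 + A / B)" using assms(1,2) by (intro divide_strict_left_mono) auto
  then show ?thesis using form assms(1,2) by simp
qed

theorem theorem5p1:
  fixes alpha a a' :: real
  assumes "alpha > 1" and "a > 1" and "a' > 1"
    and "kneadRL alpha a" and "kneadRL alpha a'"
    and "abar alpha a < abar alpha a'"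
  shows "(\<forall>n. r_e alpha a n < r_e alpha a' n \<and> r_o alpha a n < r_o alpha a' n) \<and>
         (\<forall>n. pc (orb alpha a' (n+2)) (orb alpha a' n) (orb alpha a' (n+4))
               - pc (orb alpha a (n+2)) (orb alpha a n) (orb alpha a (n+4))
             > pc 1 (-1) (orb alpha a' 2) - pc 1 (-1) (orb alpha a 2))"
proof -
  define t where "t = a powr (alpha - 1) - 1"
  define t' where "t' = a' powr (alpha - 1) - 1"
  note k = kneadRL_kneading[OF assms(1,2,4), folded t_def]
  note k' = kneadRL_kneading[OF assms(1,3,5), folded t'_def]
  interpret k: kneading alpha t by (rule k(1))
  interpret k': kneading alpha t' by (rule k'(1))
  have o2: "orb alpha a 2 = - t" "orb alpha a' 2 = - t'" using k(2)[of 2] k'(2)[of 2] k.E_2 k'.E_2 by auto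
  have t01: "0 < t" "t < 1" "0 < t'" "t' < 1" using k.t0 k.t1 k'.t0 k'.t1 by auto
  have "ln (t / (1 - t)) < ln (t' / (1 - t'))"
    using assms(6) t01 by (simp add: abar_def pc_def o2)
  then have "t / (1 - t) < t' / (1 - t')" using t01 by (subst (asm) ln_less_cancel_iff) auto
  then have tt': "t < t'" using t01 by (simp add: divide_simps) (simp add: algebra_simps)
  \<comment> \<open>At even n all three points change sign, which leaves the quotient
    unchanged.\<close>
  have pc_eq: "pc (orb alpha a (n+2)) (orb alpha a n) (orb alpha a (n+4))
      = ln ((aorb alpha t (n+4) - aorb alpha t (n+2)) / (aorb alpha t n - aorb alpha t (n+4)))"
    "pc (orb alpha a' (n+2)) (orb alpha a' n) (orb alpha a' (n+4))
      = ln ((aorb alpha t' (n+4) - aorb alpha t' (n+2)) / (aorb alpha t' n - aorb alpha t' (n+4)))" for n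
    unfolding pc_def k(2) k'(2) by (auto simp: diff_quot_commute[of "aorb alpha _ (Suc (Suc n))"])
  have pc1: "pc 1 (-1) (- u) = ln ((1 + u) / (1 - u))" if "0 < u" "u < 1" for u :: real
    unfolding pc_def by (subst diff_quot_commute) simp
  have inc: "ln ((aorb alpha t' (n+4) - aorb alpha t' (n+2)) / (aorb alpha t' n - aorb alpha t' (n+4)))
       - ln ((aorb alpha t (n+4) - aorb alpha t (n+2)) / (aorb alpha t n - aorb alpha t (n+4)))
    > ln ((1 + t') / (1 - t')) - ln ((1 + t) / (1 - t))" for n
    by (rule log_ratio_increase[OF k'(1) t01(1) tt'])
  have "(1 + t) / (1 - t) < (1 + t') / (1 - t')" using t01 tt' by (intro frac_less) auto
  \<comment> \<open>The lower bound in \<open>inc\<close> is thus positive, so each Poincare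
    coordinate increases, and with it the ratio.\<close>
  then have base: "ln ((1 + t) / (1 - t)) < ln ((1 + t') / (1 - t'))" using t01 by (subst ln_less_cancel_iff) auto
  have r: "\<bar>orb alpha a (n+4) - orb alpha a (n+2)\<bar> / \<bar>orb alpha a (n+2) - orb alpha a n\<bar>
    < \<bar>orb alpha a' (n+4) - orb alpha a' (n+2)\<bar> / \<bar>orb alpha a' (n+2) - orb alpha a' n\<bar>" for n
  proof -
    have "\<bar>aorb alpha t (n+4) - aorb alpha t (n+2)\<bar> / \<bar>(aorb alpha t (n+4) - aorb alpha t (n+2)) + (aorb alpha t n - aorb alpha t (n+4))\<bar>
      < \<bar>aorb alpha t' (n+4) - aorb alpha t' (n+2)\<bar> / \<bar>(aorb alpha t' (n+4) - aorb alpha t' (n+2)) + (aorb alpha t' n - aorb alpha t' (n+4))\<bar>"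
      using inc[of n] base by (intro ratio_less_of_ln_less k.E_ratio_pos k'.E_ratio_pos) linarith
    then show ?thesis unfolding k(2) k'(2) by (auto simp: abs_minus_commute)
  qed
  show ?thesis
  proof (intro conjI allI)
    fix n
    show "r_e alpha a n < r_e alpha a' n" using r[of "2 * n"] by (simp add: r_e_def)
    show "r_o alpha a n < r_o alpha a' n" using r[of "2 * n + 1"] by (simp add: r_o_def add.commute numeral_3_eq_3)
    show "pc (orb alpha a' (n+2)) (orb alpha a' n) (orb alpha a' (n+4))
               - pc (orb alpha a (n+2)) (orb alpha a n) (orb alpha a (n+4))
             > pc 1 (-1) (orb alpha a' 2) - pc 1 (-1) (orb alpha a 2)"
      unfolding pc_eq o2 using inc[of n] pc1[of t] pc1[of t'] t01 by simp
  qed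
qed

end
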